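(* Let $\kappa$ be a nonnegative integer, let $w \in \mathbf{N}_\kappa$, and let $x_0 \in \mathbb{R}$. Suppose that the limit $\lim_{z \to x_0} |w(z)|$ exists and equals infinity. Then the following statements are equivalent: 1. $d := \liminf_{z \to x_0} K_{-1/w}(z,z) \in \mathbb{R}\setminus\{0\}$. 2. The nontangential limit $\tilde d := \lim_{z \to x_0} K_{-1/w}(z,z)$ exists and belongs to $\mathbb{R}\setminus\{0\}$. 3. The nontangential limit $w_{-1} := \lim_{z \to x_0} (z-x_0) w(z)$ exists and belongs to $\mathbb{R}\setminus\{0\}$. 4. The nontangential limit $\tilde w_{-1} := -\lim_{z \to x_0} (z-x_0)^2 w'(z)$ exists and belongs to $\mathbb{R}\setminus\{0\}$. In this case, $d = \tilde d = w_{-1} = \tilde w_{-1}$.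
   Context: $\mathbb{C}^+$ is the open upper half plane. For a function $f$ meromorphic on $\mathbb{C}^+$, $\rho(f) \subset \mathbb{C}^+$ denotes its domain of analyticity, and $K_f(z,\zeta) = \frac{f(z)-\overline{f(\zeta)}}{z-\bar\zeta}$ for $z,\zeta \in \rho(f)$. The generalized Nevanlinna class $\mathbf{N}_\kappa$ is the set of functions $w$ meromorphic on $\mathbb{C}^+$ such that $K_w$ has $\kappa$ negative squares on $\rho(w)\times\rho(w)$: for every $m$ and $z_1,\dots,z_m \in \rho(w)$ the Hermitian matrix $[K_w(z_j,z_i)]_{i,j=1}^m$ has at most $\kappa$ negative eigenvalues, and for some choice of $m$ and points it has exactly $\kappa$. Limits are nontangential, i.e. taken with $z \to x_0$ staying in a nontangential neighborhood of $x_0$ in $\mathbb{C}^+$; the limit inferior is taken with $z \to x_0$ arbitrarily from within $\mathbb{C}^+$.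
   Formalization: The final clause is corrected to d = d̃ = −1/w₋₁ and w₋₁ = w̃₋₁; the stated equality d = w₋₁ is false (w = −1/z at x₀ = 0 gives d = 1, w₋₁ = −1). *)

theory Defs
  imports "HOL-Complex_Analysis.Complex_Analysis" "Jordan_Normal_Form.Char_Poly"
begin

abbreviation upper_half_plane :: "complex set"
  where "upper_half_plane \<equiv> {z. 0 < Im z}"

definition analyticity_domain :: "(complex \<Rightarrow> complex) \<Rightarrow> complex set"
  where "analyticity_domain f = {z \<in> upper_half_plane. f analytic_on {z}}"

definition nev_kernel :: "(complex \<Rightarrow> complex) \<Rightarrow> complex \<Rightarrow> complex \<Rightarrow> complex"
  where "nev_kernel f z \<zeta> = (f z - cnj (f \<zeta>)) / (z - cnj \<zeta>)"

definition nev_matrix :: "(complex \<Rightarrow> complex) \<Rightarrow> complex list \<Rightarrow> complex mat"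
  where "nev_matrix f zs =
    mat (length zs) (length zs) (\<lambda>(i, j). nev_kernel f (zs ! j) (zs ! i))"

(* Eigenvalues are counted with their multiplicity as roots of the characteristic polynomial;
   Polynomial.order is written in full because HOL-Algebra also has a constant "order". *)
definition num_neg_eigenvalues :: "complex mat \<Rightarrow> nat"
  where "num_neg_eigenvalues A =
    (\<Sum>\<mu> \<in> {\<mu>. eigenvalue A \<mu> \<and> \<mu> \<in> \<real> \<and> Re \<mu> < 0}. Polynomial.order \<mu> (char_poly A))"

(* A meromorphic function is represented by the total function that takes the value 0 at its
   poles and is continuous elsewhere in the half plane ("nicely meromorphic").  This picks
   one representative on the half plane of each meromorphic function, so the domain of
   analyticity is the complement of the set of poles.  Since 1 / 0 = 0, the representative of
   - 1 / w is the pointwise quotient, including at the zeros and the poles of w. *)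
definition gen_nevanlinna :: "nat \<Rightarrow> (complex \<Rightarrow> complex) set"
  where "gen_nevanlinna \<kappa> = {w. w nicely_meromorphic_on upper_half_plane \<and>
    (\<forall>zs. set zs \<subseteq> analyticity_domain w \<longrightarrow> num_neg_eigenvalues (nev_matrix w zs) \<le> \<kappa>) \<and>
    (\<exists>zs. set zs \<subseteq> analyticity_domain w \<and> num_neg_eigenvalues (nev_matrix w zs) = \<kappa>)}"

definition nontangential_region :: "real \<Rightarrow> real \<Rightarrow> complex set"
  where "nontangential_region a x0 =
    {z \<in> upper_half_plane. cmod (z - complex_of_real x0) < a * Im z}"

(* A property holds eventually for the supremum of a family of filters iff it holds eventually
   for each of them, so a limit along this filter is one common limit in all nontangential
   regions.  D is the domain of the function whose limit is taken.  For a \<le> 1 the region is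
   empty. *)
definition nontangential :: "real \<Rightarrow> complex set \<Rightarrow> complex filter"
  where "nontangential x0 D =
    (SUP a\<in>{1<..}. at (complex_of_real x0) within (nontangential_region a x0 \<inter> D))"

end

theory Submission
  imports Defs "Jordan_Normal_Form.Schur_Decomposition" "Jordan_Normal_Form.Spectral_Radius"
begin

text \<open>
  A maximal system of vectors that are orthonormal for \<open>- K\<^sub>w\<close> splits off the negative part of
  the kernel: finitely many functions \<open>\<phi>\<^sub>l = A\<^sub>l + B\<^sub>l w\<close>, with \<open>A\<^sub>l\<close> and \<open>B\<^sub>l\<close> analytic near the real
  axis, make \<open>K\<^sub>w(z,\<zeta>) + (\<Sum>l. \<phi>\<^sub>l(z) cnj (\<phi>\<^sub>l(\<zeta>)))\<close> positive semidefinite. The same form persists for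
  \<open>v = - 1 / w\<close>. If \<open>K\<^sub>v(z\<^sub>k,z\<^sub>k)\<close> tends to \<open>d = liminf K\<^sub>v(z,z)\<close>, then \<open>v(z\<^sub>k)\<close> has to tend to 0 along a
  subsequence, and in the limit the Cauchy-Schwarz inequality for the completed kernel at \<open>z\<close> and \<open>z\<^sub>k\<close> bounds the difference
  quotient \<open>g(z) = v(z) / (z - x\<^sub>0)\<close> nontangentially. In the vertical direction \<open>K\<^sub>v(u,u)\<close> is
  asymptotically \<open>Re g(u)\<close>, so that the same inequality together with the minimality of \<open>d\<close> forces
  \<open>g(u)\<close> to tend to \<open>d\<close>; Cauchy-Schwarz for the difference of the kernel functions at \<open>u\<close> and at the
  boundary point then transfers the limit from \<open>u\<close> to any \<open>z\<close> of comparable size. No integral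
  representation or factorization of \<open>w\<close> is needed.
\<close>

section \<open>Hermitian matrices and their negative eigenvalues\<close>

unbundle no vec_syntax
no_notation fps_nth (infixl "$" 75)

text \<open>The main obstacle is a mismatch of approaches. The limit inferior admits arbitrary
  approach to \<open>x0\<close>, while \<open>|w|\<close> tends to infinity only nontangentially, so
  nothing is known in advance about \<open>v\<close> along a sequence that realizes the limit
  inferior. The remedy is a rigidity property shared by \<open>w\<close> and \<open>v\<close>: one
  sequence, tangential or not, along which the function converges and its diagonal kernel values are
  bounded above already determines the nontangential limit. For \<open>v\<close> this identifies the
  limit as 0; if instead \<open>v\<close> stays large, then \<open>w\<close> is small with bounded
  kernel values and would have a finite nontangential limit.

  A second obstacle is that \<open>K_v(z,\<zeta>) = K_w(z,\<zeta>) / (w(z) cnj (w(\<zeta>)))\<close>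
  makes sense only off the zeros and poles of \<open>w\<close>, whereas the limits concern the full
  domains of analyticity. The kernel arguments therefore run on the dense set where \<open>w\<close>
  is nonzero, and limits are carried over by continuity.\<close>

lemma adjoint_mult_vec_cscalar_prod:
  fixes B C :: "complex mat"
  assumes B: "B \<in> carrier_mat n n" and C: "C \<in> carrier_mat n n"
    and BC: "\<And>i j. i < n \<Longrightarrow> j < n \<Longrightarrow> B $$ (i, j) = cnj (C $$ (j, i))"
    and x: "x \<in> carrier_vec n" and y: "y \<in> carrier_vec n"
  shows "(B *\<^sub>v x) \<bullet>c y = x \<bullet>c (C *\<^sub>v y)"
proof -
  have "(B *\<^sub>v x) \<bullet>c y = (\<Sum>i<n. (\<Sum>j<n. B $$ (i, j) * x $ j) * cnj (y $ i))"
    using assms by (auto simp: scalar_prod_def atLeast0LessThan intro!: sum.cong)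
  also have "\<dots> = (\<Sum>i<n. \<Sum>j<n. x $ j * cnj (C $$ (j, i) * y $ i))"
    unfolding sum_distrib_right using BC by (intro sum.cong refl) (simp add: algebra_simps)
  also have "\<dots> = (\<Sum>j<n. \<Sum>i<n. x $ j * cnj (C $$ (j, i) * y $ i))"
    by (rule sum.swap)
  also have "\<dots> = (\<Sum>j<n. x $ j * cnj (\<Sum>i<n. C $$ (j, i) * y $ i))"
    by (simp add: sum_distrib_left)
  also have "\<dots> = x \<bullet>c (C *\<^sub>v y)"
    using assms by (auto simp: scalar_prod_def atLeast0LessThan intro!: sum.cong)
  finally show ?thesis .
qed

lemma cscalar_prod_self:
  fixes v :: "complex vec"
  shows "v \<bullet>c v = of_real (\<Sum>i<dim_vec v. (cmod (v $ i))\<^sup>2)"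
  by (auto simp: scalar_prod_def atLeast0LessThan complex_norm_square simp del: of_real_power
      intro!: sum.cong)

text \<open>Gram-Schmidt in the library does not normalise its vectors, and the deflated matrix is
  Hermitian only for a unitary change of basis.\<close>

lemma unitary_first_column:
  fixes v :: "complex vec"
  assumes v: "v \<in> carrier_vec n" and v0: "v \<noteq> 0\<^sub>v n"
  obtains c ws where "c \<noteq> 0" "set ws \<subseteq> carrier_vec n" "corthogonal ws" "length ws = n"
    "hd ws = c \<cdot>\<^sub>v v" "\<And>w. w \<in> set ws \<Longrightarrow> w \<bullet>c w = 1"
proof -
  interpret cof_vec_space n "TYPE(complex)" .
  define b where "b = basis_completion v"
  note bc = basis_completion[OF v v0, folded b_def]
  have n: "n \<noteq> 0"
    using v v0 by (auto intro!: eq_vecI)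
  from bc(6,7) n obtain vs where bv: "b = v # vs" by (cases b) auto
  define us where "us = gram_schmidt n b"
  from gram_schmidt_result[OF bc(2) bc(4) bc(5) us_def]
  have us: "set us \<subseteq> carrier_vec n" "corthogonal us" "length us = n"
    using bc(6) by auto
  have hdus: "hd us = v" unfolding us_def bv by (rule gram_schmidt_hd[OF v])
  define r where "r u = sqrt (\<Sum>i<n. (cmod (u $ i))\<^sup>2)" for u :: "complex vec"
  define f where "f u = complex_of_real (1 / r u) \<cdot>\<^sub>v u" for u
  have self: "u \<bullet>c u = of_real ((r u)\<^sup>2)" if "u \<in> carrier_vec n" for u
    using that cscalar_prod_self[of u] by (simp add: r_def sum_nonneg)
  have r0: "r u \<noteq> 0" if u: "u \<in> set us" for u
  proof -
    from u obtain i where "i < length us" "u = us ! i" unfolding in_set_conv_nth by blast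
    then have "u \<bullet>c u \<noteq> 0" using corthogonalD[OF us(2), of i i] by auto
    with self us(1) u show ?thesis by auto
  qed
  have inner: "f u \<bullet>c f u' = of_real (1 / (r u * r u')) * (u \<bullet>c u')"
    if "u \<in> carrier_vec n" "u' \<in> carrier_vec n" for u u'
    using that by (simp add: f_def conjugate_smult_vec)
  define ws where "ws = map f us"
  show ?thesis
  proof (rule that[of "complex_of_real (1 / r v)" ws])
    show "complex_of_real (1 / r v) \<noteq> 0" using r0 hdus n us(3) hd_in_set[of us] by force
    show "set ws \<subseteq> carrier_vec n" using us(1) by (auto simp: ws_def f_def)
    show "length ws = n" using us by (simp add: ws_def)
    show "hd ws = complex_of_real (1 / r v) \<cdot>\<^sub>v v"
      using hdus n us(3) by (cases us) (auto simp: ws_def f_def)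
    show "corthogonal ws"
    proof
      fix i j assume ij: "i < length ws" "j < length ws"
      then have c: "us ! i \<in> set us" "us ! j \<in> set us" by (auto simp: ws_def)
      then show "(ws ! i \<bullet>c ws ! j = 0) = (i \<noteq> j)"
        using ij inner[OF subsetD[OF us(1) c(1)] subsetD[OF us(1) c(2)]] r0[OF c(1)] r0[OF c(2)]
          corthogonalD[OF us(2), of i j] by (auto simp: ws_def)
    qed
    fix w assume "w \<in> set ws"
    then obtain u where u: "u \<in> set us" "w = f u" by (auto simp: ws_def)
    with us(1) have "u \<in> carrier_vec n" by auto
    then show "w \<bullet>c w = 1"
      using inner[of u u] self[of u] r0[OF u(1)] by (simp add: u(2) power2_eq_square)
  qed
qed

text \<open>A multiset, because \<open>proots\<close> turns products of polynomials into sums: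
  splitting off one linear factor then changes the count by at most one.\<close>

definition neg_proots :: "complex poly \<Rightarrow> complex multiset"
  where "neg_proots p = {#\<mu> \<in># proots p. \<mu> \<in> \<real> \<and> Re \<mu> < 0#}"

lemma num_neg_eigenvalues_conv_proots:
  assumes A: "A \<in> carrier_mat n n"
  shows "num_neg_eigenvalues A = size (neg_proots (char_poly A))"
proof -
  have p0: "char_poly A \<noteq> 0" using degree_monic_char_poly[OF A] by auto
  have "set_mset (neg_proots (char_poly A)) = {\<mu>. eigenvalue A \<mu> \<and> \<mu> \<in> \<real> \<and> Re \<mu> < 0}"
    using eigenvalue_root_char_poly[OF A] p0 by (auto simp: neg_proots_def)
  then show ?thesis
    using p0 by (auto simp: num_neg_eigenvalues_def size_multiset_overloaded_eq neg_proots_def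
        intro!: sum.cong)
qed

text \<open>A weak form of the spectral theorem, with eigenvectors for the negative eigenvalues in
  the role of \<open>F\<close>. Induction deflates one eigenvector at a time. Independence of
  \<open>F\<close> is not claimed, since only its length enters the later dimension count.\<close>

lemma hermitian_nonneg_on_small_codim:
  fixes A :: "complex mat"
  assumes "A \<in> carrier_mat n n"
    and "\<And>i j. i < n \<Longrightarrow> j < n \<Longrightarrow> A $$ (i, j) = cnj (A $$ (j, i))"
  shows "\<exists>F. set F \<subseteq> carrier_vec n \<and> length F = num_neg_eigenvalues A \<and>
    (\<forall>x\<in>carrier_vec n. (\<forall>f\<in>set F. x \<bullet>c f = 0) \<longrightarrow> 0 \<le> Re ((A *\<^sub>v x) \<bullet>c x))"
  using assms
proof (induction n arbitrary: A)
  case 0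
  have "degree (char_poly A) = 0" "coeff (char_poly A) 0 = 1" using degree_monic_char_poly[OF 0(1)] by auto
  then have "char_poly A = 1" by (metis coeff_pCons_0 one_pCons degree_eq_zeroE)
  then have "num_neg_eigenvalues A = 0"
    using num_neg_eigenvalues_conv_proots[OF 0(1)] by (simp add: neg_proots_def)
  moreover have "(A *\<^sub>v x) \<bullet>c x = 0" if "x \<in> carrier_vec 0" for x
    using that by (simp add: scalar_prod_def)
  ultimately show ?case by (intro exI[of _ "[]"]) auto
next
  case (Suc n A)
  note A = Suc.prems(1) and herm = Suc.prems(2)
  have sa: "(A *\<^sub>v x) \<bullet>c y = x \<bullet>c (A *\<^sub>v y)" if "x \<in> carrier_vec (Suc n)" "y \<in> carrier_vec (Suc n)" for x y
    by (rule adjoint_mult_vec_cscalar_prod[OF A A herm that])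
  from spectrum_non_empty[OF A] obtain e where "eigenvalue A e"
    by (auto simp: spectrum_def)
  then obtain v where "eigenvector A v e" by (auto simp: eigenvalue_def)
  then have v: "v \<in> carrier_vec (Suc n)" "v \<noteq> 0\<^sub>v (Suc n)" "A *\<^sub>v v = e \<cdot>\<^sub>v v"
    using A by (auto simp: eigenvector_def)
  obtain c ws where c: "c \<noteq> 0" and ws: "set ws \<subseteq> carrier_vec (Suc n)" "corthogonal ws" "length ws = Suc n"
    and hdws: "hd ws = c \<cdot>\<^sub>v v" and norm: "\<And>w. w \<in> set ws \<Longrightarrow> w \<bullet>c w = 1"
    using unitary_first_column[OF v(1,2)] by metis
  define v' where "v' = c \<cdot>\<^sub>v v"
  have v': "v' \<in> carrier_vec (Suc n)" "A *\<^sub>v v' = e \<cdot>\<^sub>v v'"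
    using v A c by (auto simp: v'_def mult_mat_vec smult_smult_assoc mult.commute)
  have "hd ws \<in> set ws" using ws(3) by (cases ws) auto
  then have nv': "v' \<bullet>c v' = 1" using norm hdws by (simp add: v'_def)
  then have v'0: "v' \<noteq> 0\<^sub>v (Suc n)" by auto
  have "e * (v' \<bullet>c v') = cnj e * (v' \<bullet>c v')"
    using sa[OF v'(1) v'(1)] v' by (simp add: conjugate_smult_vec)
  then have e: "e \<in> \<real>" using nv' by (simp add: Reals_cnj_iff)
  define W where "W = mat_of_cols (Suc n) ws"
  define W' where "W' = corthogonal_inv W"
  have W: "W \<in> carrier_mat (Suc n) (Suc n)" using ws(3) by (auto simp: W_def)
  have W': "W' \<in> carrier_mat (Suc n) (Suc n)" using W by (auto simp: W'_def corthogonal_inv_def)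
  \<comment> \<open>\<open>corthogonal_inv\<close> divides each conjugated column by its squared
    norm; since these norms are 1, the inverse is the adjoint.\<close>
  have W'W_entry: "W' $$ (i, j) = cnj (W $$ (j, i))" if "i < Suc n" "j < Suc n" for i j
  proof -
    have "ws ! i \<in> set ws" using that ws(3) by auto
    then have "ws ! i \<bullet>c ws ! i = 1" "ws ! i \<in> carrier_vec (Suc n)" using norm ws(1) by auto
    moreover have "cols W ! i = ws ! i" using that ws by (simp add: W_def cols_mat_of_cols)
    moreover have "dim_row W = Suc n" "length (cols W) = Suc n" using W by auto
    ultimately have "W' $$ (i, j) = cnj (ws ! i $ j)"
      using that by (simp add: W'_def corthogonal_inv_def mat_of_rows_index vec_inv_def)
    then show ?thesis using that ws by (simp add: W_def mat_of_cols_index)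
  qed
  have cW: "corthogonal_mat W" using orthogonal_mat_of_cols[OF ws] by (simp add: W_def)
  then have W'W: "W' * W = 1\<^sub>m (Suc n)"
    using corthogonal_inv_result[OF cW] W' by (auto simp: inverts_mat_def W'_def)
  then have WW': "W * W' = 1\<^sub>m (Suc n)" using mat_mult_left_right_inverse[OF W' W] by simp
  define A' where "A' = W' * A * W"
  have A': "A' \<in> carrier_mat (Suc n) (Suc n)" using W' A W by (auto simp: A'_def)
  have col0: "col A' 0 = vec (Suc n) (\<lambda>i. if i = 0 then e else 0)"
    unfolding A'_def W'_def W_def
    by (rule corthogonal_col_ev_0[OF A v'(1) v'0 v'(2)]) (use hdws ws in \<open>auto simp: v'_def\<close>)
  have A'form: "(A' *\<^sub>v x) \<bullet>c y = (A *\<^sub>v (W *\<^sub>v x)) \<bullet>c (W *\<^sub>v y)"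
    if x: "x \<in> carrier_vec (Suc n)" and y: "y \<in> carrier_vec (Suc n)" for x y
  proof -
    have "A' *\<^sub>v x = W' *\<^sub>v (A *\<^sub>v (W *\<^sub>v x))"
      using W' A W x by (simp add: A'_def assoc_mult_mat_vec[of _ "Suc n" "Suc n" _ "Suc n"])
    then show ?thesis
      using adjoint_mult_vec_cscalar_prod[OF W' W W'W_entry _ y, of "A *\<^sub>v (W *\<^sub>v x)"] A W x by auto
  qed
  have entry: "A' $$ (i, j) = (A' *\<^sub>v unit_vec (Suc n) j) \<bullet>c unit_vec (Suc n) i" if "i < Suc n" "j < Suc n" for i j
  proof -
    have "conjugate (unit_vec (Suc n) i :: complex vec) = unit_vec (Suc n) i"
      by (rule eq_vecI) (auto simp: unit_vec_def)
    then show ?thesis using that A' by simp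
  qed
  have herm': "A' $$ (i, j) = cnj (A' $$ (j, i))" if "i < Suc n" "j < Suc n" for i j
  proof -
    define p q where "p = W *\<^sub>v unit_vec (Suc n) j" and "q = W *\<^sub>v unit_vec (Suc n) i"
    have pq: "p \<in> carrier_vec (Suc n)" "q \<in> carrier_vec (Suc n)" using W by (auto simp: p_def q_def)
    have "A' $$ (i, j) = (A *\<^sub>v p) \<bullet>c q"
      using entry[OF that] A'form by (simp add: p_def q_def)
    also have "\<dots> = p \<bullet>c (A *\<^sub>v q)" by (rule sa[OF pq])
    also have "\<dots> = cnj ((A *\<^sub>v q) \<bullet>c p)"
      using pq A by (simp add: scalar_prod_def mult.commute)
    also have "(A *\<^sub>v q) \<bullet>c p = A' $$ (j, i)"
      using entry[OF that(2,1)] A'form by (simp add: p_def q_def)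
    finally show ?thesis .
  qed
  define A1 where "A1 = mat 1 1 (\<lambda>_. e)"
  define A3 where "A3 = mat n n (\<lambda>(i, j). A' $$ (Suc i, Suc j))"
  have A1: "A1 \<in> carrier_mat 1 1" and A3: "A3 \<in> carrier_mat n n" by (auto simp: A1_def A3_def)
  have A'0: "A' $$ (i, 0) = (if i = 0 then e else 0)" if "i < Suc n" for i
    using arg_cong[OF col0, of "\<lambda>v. v $ i"] that A' by auto
  \<comment> \<open>The first column is known because \<open>v'\<close> is an eigenvector; the first
    row then vanishes off the diagonal by Hermitian symmetry.\<close>
  have block: "A' = four_block_mat A1 (0\<^sub>m 1 n) (0\<^sub>m n 1) A3"
  proof (rule eq_matI)
    fix i j assume "i < dim_row (four_block_mat A1 (0\<^sub>m 1 n) (0\<^sub>m n 1) A3)"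
      "j < dim_col (four_block_mat A1 (0\<^sub>m 1 n) (0\<^sub>m n 1) A3)"
    then have "i < Suc n" "j < Suc n" using A1 A3 by auto
    then show "A' $$ (i, j) = four_block_mat A1 (0\<^sub>m 1 n) (0\<^sub>m n 1) A3 $$ (i, j)"
      using A1 A3 A'0 herm'[of 0 j]
      by (cases i; cases j) (auto simp: A1_def A3_def)
  qed (use A' A1 A3 in auto)
  have "similar_mat_wit A' A W' W"
    by (rule similar_mat_witI[of _ _ "Suc n"]) (use W W' A A' W'W WW' in \<open>auto simp: A'_def\<close>)
  then have "char_poly A = char_poly A'"
    using char_poly_similar by (metis similar_mat_def)
  also have "\<dots> = char_poly A1 * char_poly A3"
    unfolding block by (rule char_poly_four_block_zeros_col[OF A1 _ A3]) auto
  also have "char_poly A1 = [:-e, 1:]"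
    by (simp add: A1_def char_poly_defs det_def sign_def)
  finally have cpA: "char_poly A = [:-e, 1:] * char_poly A3" .
  moreover have "char_poly A3 \<noteq> 0" using degree_monic_char_poly[OF A3] by auto
  ultimately have "proots (char_poly A) = {#e#} + proots (char_poly A3)"
    unfolding cpA by (subst proots_mult) (auto simp: proots_linear_factor)
  then have num: "num_neg_eigenvalues A = (if Re e < 0 then 1 else 0) + num_neg_eigenvalues A3"
    using e by (simp add: num_neg_eigenvalues_conv_proots[OF A] num_neg_eigenvalues_conv_proots[OF A3] neg_proots_def)
  have "A3 $$ (i, j) = cnj (A3 $$ (j, i))" if "i < n" "j < n" for i j
    using herm'[of "Suc i" "Suc j"] that by (simp add: A3_def)
  from Suc.IH[OF A3 this] obtain F where F: "set F \<subseteq> carrier_vec n" "length F = num_neg_eigenvalues A3"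
    "\<And>x. x \<in> carrier_vec n \<Longrightarrow> (\<And>f. f \<in> set F \<Longrightarrow> x \<bullet>c f = 0) \<Longrightarrow> 0 \<le> Re ((A3 *\<^sub>v x) \<bullet>c x)"
    by blast
  define o1 where "o1 = vec 1 (\<lambda>_. 1::complex)"
  have o1: "o1 \<in> carrier_vec 1" by (auto simp: o1_def)
  \<comment> \<open>The constraints for the block \<open>A3\<close> are padded by 0 and rotated back
    by \<open>W\<close>. A negative \<open>e\<close> contributes one more constraint, which kills
    the eigenvector coordinate.\<close>
  define G where "G = map (\<lambda>f. W *\<^sub>v (0\<^sub>v 1 @\<^sub>v f)) F @ (if Re e < 0 then [W *\<^sub>v (o1 @\<^sub>v 0\<^sub>v n)] else [])"
  have cn: "a @\<^sub>v b \<in> carrier_vec (Suc n)" if "a \<in> carrier_vec 1" "b \<in> carrier_vec n" for a b :: "complex vec"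
    using append_carrier_vec[OF that] by simp
  have conjapp: "conjugate (a @\<^sub>v b) = conjugate a @\<^sub>v conjugate b" for a b :: "complex vec"
    by (rule eq_vecI) auto
  show ?case
  proof (intro exI[of _ G] conjI ballI impI)
    show "set G \<subseteq> carrier_vec (Suc n)" 
    proof
      fix g assume "g \<in> set G"
      then obtain u where "g = W *\<^sub>v u" by (auto simp: G_def split: if_splits)
      then show "g \<in> carrier_vec (Suc n)" using W by (metis carrier_matD(1) carrier_vecI dim_mult_mat_vec)
    qed
    show "length G = num_neg_eigenvalues A" using F(2) num by (simp add: G_def)
    fix x assume x: "x \<in> carrier_vec (Suc n)" and orth: "\<forall>g\<in>set G. x \<bullet>c g = 0"
    define y where "y = W' *\<^sub>v x"
    have y: "y \<in> carrier_vec (Suc n)" using W' x mult_mat_vec_carrier y_def by blast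
    have xWy: "x = W *\<^sub>v y"
      using x W W' WW' by (simp add: y_def assoc_mult_mat_vec[symmetric, of _ "Suc n" "Suc n" _ "Suc n"])
    obtain a b where ab: "y = a @\<^sub>v b" "a \<in> carrier_vec 1" "b \<in> carrier_vec n"
      using vec_first_last_append[of y 1 n] y by (metis plus_1_eq_Suc vec_first_carrier vec_last_carrier)
    have inner: "x \<bullet>c (W *\<^sub>v u) = y \<bullet>c u" if "u \<in> carrier_vec (Suc n)" for u
      using adjoint_mult_vec_cscalar_prod[OF W' W W'W_entry x that] by (simp add: y_def)
    have "b \<bullet>c f = 0" if f: "f \<in> set F" for f
    proof -
      have "f \<in> carrier_vec n" using f F(1) by auto
      then have "b \<bullet>c f = y \<bullet>c (0\<^sub>v 1 @\<^sub>v f)"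
        using ab scalar_prod_append[of a 1 b n "conjugate (0\<^sub>v 1)" "conjugate f"]
        by (simp add: conjapp)
      also have "\<dots> = x \<bullet>c (W *\<^sub>v (0\<^sub>v 1 @\<^sub>v f))" using inner[OF cn] \<open>f \<in> carrier_vec n\<close> by auto
      also have "\<dots> = 0" using orth f by (auto simp: G_def)
      finally show ?thesis .
    qed
    from F(3)[OF ab(3) this] have pos3: "0 \<le> Re ((A3 *\<^sub>v b) \<bullet>c b)" .
    have "a $ 0 = y \<bullet>c (o1 @\<^sub>v 0\<^sub>v n)"
      using ab scalar_prod_append[of a 1 b n "conjugate o1" "conjugate (0\<^sub>v n)"] o1
      by (simp add: conjapp) (simp add: scalar_prod_def o1_def)
    also have "\<dots> = x \<bullet>c (W *\<^sub>v (o1 @\<^sub>v 0\<^sub>v n))" using inner[OF cn] o1 by auto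
    finally have a0: "a $ 0 = 0" if "Re e < 0" using orth that by (auto simp: G_def)
    have Ay: "A' *\<^sub>v y = (A1 *\<^sub>v a) @\<^sub>v (A3 *\<^sub>v b)"
      unfolding block ab(1) by (rule mult_mat_vec_split[OF A1 A3 ab(2,3)])
    have "(A *\<^sub>v x) \<bullet>c x = (A' *\<^sub>v y) \<bullet>c y" using A'form[OF y y] by (simp add: xWy)
    also have "\<dots> = (A1 *\<^sub>v a) \<bullet>c a + (A3 *\<^sub>v b) \<bullet>c b"
      unfolding Ay unfolding ab(1) conjapp
      by (rule scalar_prod_append[of _ 1 _ n]) (use ab A1 A3 in auto)
    also have "(A1 *\<^sub>v a) \<bullet>c a = e * (a $ 0 * cnj (a $ 0))"
      using ab(2) by (simp add: A1_def scalar_prod_def)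
    finally have "Re ((A *\<^sub>v x) \<bullet>c x) = Re e * (cmod (a $ 0))\<^sup>2 + Re ((A3 *\<^sub>v b) \<bullet>c b)"
      using e by (simp add: complex_mult_cnj cmod_power2 complex_is_Real_iff)
    then show "0 \<le> Re ((A *\<^sub>v x) \<bullet>c x)" using pos3 a0 by (cases "Re e < 0") auto
  qed
qed

text \<open>Padding the \<open>m\<close> equations with zero rows gives a square matrix whose row
  \<open>m\<close> is zero, hence a singular one.\<close>

lemma exists_nontrivial_homogeneous_solution:
  fixes M :: "nat \<Rightarrow> nat \<Rightarrow> complex"
  assumes "m < k"
  shows "\<exists>c. (\<exists>l<k. c l \<noteq> 0) \<and> (\<forall>i<m. (\<Sum>l<k. M i l * c l) = 0)"
proof -
  define B where "B = mat k k (\<lambda>(i, l). if i < m then M i l else 0)"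
  have B: "B \<in> carrier_mat k k" by (auto simp: B_def)
  have "B = mat\<^sub>r k k (\<lambda>i. if i = m then 0\<^sub>v k else row B i)"
    using assms by (auto simp: B_def)
  also have "det \<dots> = 0" by (rule det_row_0) (use assms B in auto)
  finally have "det B = 0" .
  then obtain v where v: "v \<in> carrier_vec k" "v \<noteq> 0\<^sub>v k" "B *\<^sub>v v = 0\<^sub>v k"
    using det_0_iff_vec_prod_zero_field[OF B] by auto
  show ?thesis
  proof (intro exI[of _ "\<lambda>l. v $ l"] conjI allI impI)
    show "\<exists>l<k. v $ l \<noteq> 0" using v by (auto intro!: eq_vecI)
    fix i assume i: "i < m"
    have "(B *\<^sub>v v) $ i = 0" using v i assms by auto
    then show "(\<Sum>l<k. M i l * v $ l) = 0"
      using i assms v(1) by (auto simp: B_def scalar_prod_def atLeast0LessThan)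
  qed
qed

section \<open>Kernels with finitely many negative squares\<close>

text \<open>Coefficients are functions of the point rather than tuples, so that forms over different
  finite sets can be compared through the supports.\<close>

definition kform :: "(complex \<Rightarrow> complex \<Rightarrow> complex) \<Rightarrow> complex set \<Rightarrow> (complex \<Rightarrow> complex) \<Rightarrow> (complex \<Rightarrow> complex) \<Rightarrow> complex"
  where "kform K S a b = (\<Sum>z\<in>S. \<Sum>\<zeta>\<in>S. a z * cnj (b \<zeta>) * K z \<zeta>)"

definition hermitian_kernel :: "complex set \<Rightarrow> (complex \<Rightarrow> complex \<Rightarrow> complex) \<Rightarrow> bool"
  where "hermitian_kernel D K \<longleftrightarrow> (\<forall>z\<in>D. \<forall>\<zeta>\<in>D. K \<zeta> z = cnj (K z \<zeta>))"

definition psd_kernel :: "complex set \<Rightarrow> (complex \<Rightarrow> complex \<Rightarrow> complex) \<Rightarrow> bool"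
  where "psd_kernel D K \<longleftrightarrow> (\<forall>S a. finite S \<and> S \<subseteq> D \<longrightarrow> 0 \<le> Re (kform K S a a))"

lemma kform_add_left: "kform K S (\<lambda>z. a z + a' z) b = kform K S a b + kform K S a' b"
  by (simp add: kform_def algebra_simps sum.distrib)

lemma kform_add_right: "kform K S a (\<lambda>z. b z + b' z) = kform K S a b + kform K S a b'"
  by (simp add: kform_def algebra_simps sum.distrib)

lemma kform_scale_left: "kform K S (\<lambda>z. c * a z) b = c * kform K S a b"
  by (simp add: kform_def algebra_simps sum_distrib_left)

lemma kform_scale_right: "kform K S a (\<lambda>z. c * b z) = cnj c * kform K S a b"
  by (simp add: kform_def algebra_simps sum_distrib_left)

lemma kform_sum_left: "kform K S (\<lambda>z. \<Sum>l\<in>L. c l * a l z) b = (\<Sum>l\<in>L. c l * kform K S (a l) b)"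
proof (induction L rule: infinite_finite_induct)
  case (insert x F)
  then show ?case by (simp add: kform_add_left kform_scale_left)
qed (auto simp: kform_def)

lemma kform_sum_right: "kform K S b (\<lambda>z. \<Sum>l\<in>L. c l * a l z) = (\<Sum>l\<in>L. cnj (c l) * kform K S b (a l))"
proof (induction L rule: infinite_finite_induct)
  case (insert x F)
  then show ?case by (simp add: kform_add_right kform_scale_right)
qed (auto simp: kform_def)

lemma kform_mono_neutral:
  assumes "finite T" "S \<subseteq> T" "\<And>z. z \<notin> S \<Longrightarrow> a z = 0" "\<And>z. z \<notin> S \<Longrightarrow> b z = 0"
  shows "kform K T a b = kform K S a b"
proof -
  have "(\<Sum>\<zeta>\<in>T. a z * cnj (b \<zeta>) * K z \<zeta>) = (\<Sum>\<zeta>\<in>S. a z * cnj (b \<zeta>) * K z \<zeta>)" for z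
    using assms by (intro sum.mono_neutral_right) auto
  then show ?thesis
    unfolding kform_def using assms by (simp, intro sum.mono_neutral_right) auto
qed

lemma kform_sym:
  assumes "hermitian_kernel D K" "S \<subseteq> D"
  shows "kform K S b a = cnj (kform K S a b)"
proof -
  have "kform K S b a = (\<Sum>\<zeta>\<in>S. \<Sum>z\<in>S. b z * cnj (a \<zeta>) * K z \<zeta>)"
    unfolding kform_def by (rule sum.swap)
  also have "\<dots> = cnj (kform K S a b)"
    unfolding kform_def cnj_sum
  proof (intro sum.cong refl)
    fix \<zeta> z assume "\<zeta> \<in> S" "z \<in> S"
    then have "K z \<zeta> = cnj (K \<zeta> z)" using assms by (auto simp: hermitian_kernel_def)
    then show "b z * cnj (a \<zeta>) * K z \<zeta> = cnj (a \<zeta> * cnj (b z) * K \<zeta> z)" by simp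
  qed
  finally show ?thesis .
qed

text \<open>The form may be degenerate. If \<open>B > 0\<close>, the choice \<open>t = 1 / B\<close>
  in \<open>main\<close> is the classical one; if \<open>B = 0\<close>, the bound in
  \<open>main\<close> is affine in \<open>t\<close> with slope \<open>- 2 |\<alpha>|^2\<close>, and
  the chosen \<open>t\<close> would give it the value -1 unless \<open>\<alpha> = 0\<close>.\<close>

lemma kform_Cauchy_Schwarz:
  assumes K: "hermitian_kernel D K" "psd_kernel D K" and S: "finite S" "S \<subseteq> D"
  shows "(cmod (kform K S a b))\<^sup>2 \<le> Re (kform K S a a) * Re (kform K S b b)"
proof -
  define \<alpha> where "\<alpha> = kform K S a b"
  define A B where "A = Re (kform K S a a)" and "B = Re (kform K S b b)"
  have pos: "0 \<le> Re (kform K S c c)" for c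
    using K(2) S by (auto simp: psd_kernel_def)
  have ba: "kform K S b a = cnj \<alpha>" unfolding \<alpha>_def by (rule kform_sym[OF K(1) S(2)])
  have main: "0 \<le> A - 2 * t * (cmod \<alpha>)\<^sup>2 + t\<^sup>2 * (cmod \<alpha>)\<^sup>2 * B" for t :: real
  proof -
    define c where "c = - complex_of_real t * \<alpha>"
    have "kform K S (\<lambda>z. a z + c * b z) (\<lambda>z. a z + c * b z) =
        kform K S a a + c * kform K S b a + cnj c * kform K S a b + c * cnj c * kform K S b b"
      by (simp add: kform_add_left kform_add_right kform_scale_left kform_scale_right algebra_simps)
    also have "\<dots> = kform K S a a - of_real (2 * t * (cmod \<alpha>)\<^sup>2) + of_real (t\<^sup>2 * (cmod \<alpha>)\<^sup>2) * kform K S b b"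
      unfolding ba \<alpha>_def[symmetric] c_def of_real_mult complex_norm_square
      by (simp add: power2_eq_square algebra_simps)
    finally have "Re (kform K S (\<lambda>z. a z + c * b z) (\<lambda>z. a z + c * b z)) =
        A - 2 * t * (cmod \<alpha>)\<^sup>2 + t\<^sup>2 * (cmod \<alpha>)\<^sup>2 * B"
      by (simp add: A_def B_def)
    with pos show ?thesis by metis
  qed
  show ?thesis
  proof (cases "B = 0")
    case True
    have "\<alpha> = 0"
    proof (rule ccontr)
      assume "\<alpha> \<noteq> 0"
      then have "(cmod \<alpha>)\<^sup>2 > 0" by simp
      then have "A - 2 * ((A + 1) / (2 * (cmod \<alpha>)\<^sup>2)) * (cmod \<alpha>)\<^sup>2 = -1" by (simp add: field_simps)
      with main[of "(A + 1) / (2 * (cmod \<alpha>)\<^sup>2)"] True show False by simp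
    qed
    then show ?thesis using pos[of a] pos[of b] by (simp add: \<alpha>_def)
  next
    case False
    then have B: "B > 0" using pos[of b] by (simp add: B_def)
    have "A - 2 * (1 / B) * (cmod \<alpha>)\<^sup>2 + (1 / B)\<^sup>2 * (cmod \<alpha>)\<^sup>2 * B = A - (cmod \<alpha>)\<^sup>2 / B"
      using B by (simp add: power2_eq_square)
    with main[of "1 / B"] have "(cmod \<alpha>)\<^sup>2 / B \<le> A" by linarith
    then show ?thesis using B by (simp add: \<alpha>_def A_def B_def field_simps)
  qed
qed

lemma psd_kernel_two_points:
  assumes K: "hermitian_kernel D K" "psd_kernel D K" and "z \<in> D" "u \<in> D"
  shows "(cmod (K z u))\<^sup>2 \<le> Re (K z z) * Re (K u u)"
proof -
  define d where "d x = (\<lambda>y. if y = x then 1 else (0 :: complex))" for x :: complex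
  have "kform K {z, u} (d x) (d y) = K x y" if "x \<in> {z, u}" "y \<in> {z, u}" for x y
    using that by (cases "z = u") (auto simp: kform_def d_def)
  with kform_Cauchy_Schwarz[OF K, of "{z, u}" "d z" "d u"] assms(3,4) show ?thesis by simp
qed

text \<open>Cauchy-Schwarz for the point mass at \<open>z\<close> and the difference of the point
  masses at \<open>u\<close> and \<open>v\<close>; the last factor is the squared distance between
  the kernel functions at \<open>u\<close> and \<open>v\<close>.\<close>

lemma psd_kernel_three_points:
  assumes K: "hermitian_kernel D K" "psd_kernel D K" and D: "z \<in> D" "u \<in> D" "v \<in> D"
  shows "(cmod (K z u - K z v))\<^sup>2 \<le> Re (K z z) * (Re (K u u) - 2 * Re (K u v) + Re (K v v))"
proof -
  define d where "d x = (\<lambda>y. if y = x then 1 else (0 :: complex))" for x :: complex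
  define S where "S = {z, u, v}"
  have S: "finite S" "S \<subseteq> D" and in_S: "z \<in> S" "u \<in> S" "v \<in> S" using D by (auto simp: S_def)
  have single: "kform K S (d x) (d y) = K x y" if "x \<in> S" "y \<in> S" for x y
  proof -
    have "kform K S (d x) (d y) = kform K {x, y} (d x) (d y)"
      by (rule kform_mono_neutral) (use that S in \<open>auto simp: d_def\<close>)
    then show ?thesis by (cases "x = y") (auto simp: kform_def d_def)
  qed
  define e where "e = (\<lambda>y. d u y + (-1) * d v y)"
  have "kform K S (d z) e = K z u - K z v"
    unfolding e_def kform_add_right kform_scale_right by (simp add: single in_S)
  moreover have "Re (kform K S e e) = Re (K u u) - 2 * Re (K u v) + Re (K v v)"
  proof -
    have "kform K S e e = K u u - K u v - K v u + K v v"
      unfolding e_def kform_add_right kform_scale_right kform_add_left kform_scale_left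
      by (simp add: single in_S)
    moreover have "Re (K v u) = Re (cnj (K u v))" using K(1) D unfolding hermitian_kernel_def by metis
    ultimately show ?thesis by simp
  qed
  ultimately show ?thesis
    using kform_Cauchy_Schwarz[OF K S, of "d z" e] single[OF in_S(1,1)] by simp
qed

text \<open>Orthonormality for \<open>- K\<close> makes the \<open>k\<close> vectors linearly
  independent and their span negative definite, so \<open>k\<close> is a lower bound for the number
  of negative squares.\<close>

definition negative_system :: "complex set \<Rightarrow> (complex \<Rightarrow> complex \<Rightarrow> complex) \<Rightarrow> nat \<Rightarrow> complex set \<Rightarrow> (nat \<Rightarrow> complex \<Rightarrow> complex) \<Rightarrow> bool"
  where "negative_system D K k S a \<longleftrightarrow> finite S \<and> S \<subseteq> D \<and> (\<forall>l<k. \<forall>z. z \<notin> S \<longrightarrow> a l z = 0) \<and>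
    (\<forall>l<k. \<forall>l'<k. kform K S (a l) (a l') = (if l = l' then -1 else 0))"

text \<open>A negative system of maximal size splits off the negative part of the kernel: if the
  completed kernel were negative on some vector, projecting that vector onto the orthogonal
  complement of the system would enlarge it.\<close>

lemma maximal_negative_system_completion:
  assumes K: "hermitian_kernel D K"
    and bound: "\<And>k S a. negative_system D K k S a \<Longrightarrow> k \<le> N"
  obtains n :: nat and S and a where "finite S" "S \<subseteq> D"
    "psd_kernel D (\<lambda>z \<zeta>. K z \<zeta> +
      (\<Sum>l<n. (\<Sum>\<xi>\<in>S. cnj (a l \<xi>) * K z \<xi>) * cnj (\<Sum>\<xi>\<in>S. cnj (a l \<xi>) * K \<zeta> \<xi>)))"
proof -
  define P where "P k \<longleftrightarrow> (\<exists>S a. negative_system D K k S a)" for k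
  define n where "n = (GREATEST k. P k)"
  have P0: "P 0" unfolding P_def negative_system_def by (intro exI[of _ "{}"]) auto
  have Pb: "P k \<Longrightarrow> k \<le> N" for k using bound by (auto simp: P_def)
  have "P n" unfolding n_def by (rule GreatestI_nat[of P 0 N]) (use P0 Pb in auto)
  then obtain S a where "negative_system D K n S a" by (auto simp: P_def)
  then have S: "finite S" "S \<subseteq> D" and supp: "\<And>l z. l < n \<Longrightarrow> z \<notin> S \<Longrightarrow> a l z = 0"
    and orth: "\<And>l l'. l < n \<Longrightarrow> l' < n \<Longrightarrow> kform K S (a l) (a l') = (if l = l' then -1 else 0)"
    by (auto simp: negative_system_def)
  define \<phi> where "\<phi> l z = (\<Sum>\<xi>\<in>S. cnj (a l \<xi>) * K z \<xi>)" for l z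
  define C where "C z \<zeta> = K z \<zeta> + (\<Sum>l<n. \<phi> l z * cnj (\<phi> l \<zeta>))" for z \<zeta>
  have "psd_kernel D C"
  proof (rule ccontr)
    assume "\<not> psd_kernel D C"
    then obtain T b0 where T: "finite T" "T \<subseteq> D" and neg: "Re (kform C T b0 b0) < 0"
      by (auto simp: psd_kernel_def not_le)
    define b where "b z = (if z \<in> T then b0 z else 0)" for z
    define U where "U = S \<union> T"
    have U: "finite U" "U \<subseteq> D" "S \<subseteq> U" "T \<subseteq> U" using S T by (auto simp: U_def)
    have "kform C T b0 b0 = kform C T b b" by (simp add: kform_def b_def)
    also have "\<dots> = kform C U b b"
      by (rule kform_mono_neutral[symmetric]) (use U in \<open>auto simp: b_def\<close>)
    finally have negU: "Re (kform C U b b) < 0" using neg by simp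
    have orthU: "kform K U (a l) (a l') = (if l = l' then -1 else 0)" if "l < n" "l' < n" for l l'
      using orth[OF that] kform_mono_neutral[OF U(1,3), of "a l" "a l'" K] supp that by auto
    define c where "c l = kform K U b (a l)" for l
    have c_eq: "c l = (\<Sum>z\<in>U. b z * \<phi> l z)" if "l < n" for l
    proof -
      have "\<phi> l z = (\<Sum>\<xi>\<in>U. cnj (a l \<xi>) * K z \<xi>)" for z
        unfolding \<phi>_def by (rule sum.mono_neutral_left) (use U supp that in auto)
      then show ?thesis by (simp add: c_def kform_def sum_distrib_left mult.assoc)
    qed
    have "kform C U b b = kform K U b b + (\<Sum>z\<in>U. \<Sum>\<zeta>\<in>U. \<Sum>l<n. (b z * \<phi> l z) * cnj (b \<zeta> * \<phi> l \<zeta>))"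
      by (simp add: kform_def C_def algebra_simps sum.distrib sum_distrib_left)
    also have "(\<Sum>z\<in>U. \<Sum>\<zeta>\<in>U. \<Sum>l<n. (b z * \<phi> l z) * cnj (b \<zeta> * \<phi> l \<zeta>)) =
        (\<Sum>l<n. \<Sum>z\<in>U. \<Sum>\<zeta>\<in>U. (b z * \<phi> l z) * cnj (b \<zeta> * \<phi> l \<zeta>))"
      by (subst sum.swap[of _ _ "{..<n}"], rule sum.cong[OF refl], subst sum.swap[of _ _ "{..<n}"]) simp
    also have "\<dots> = (\<Sum>l<n. c l * cnj (c l))"
      by (rule sum.cong[OF refl]) (simp add: c_eq sum_product)
    finally have CU: "kform C U b b = kform K U b b + (\<Sum>l<n. c l * cnj (c l))" .
    \<comment> \<open>The system has square -1 instead of 1, so the component of \<open>b\<close>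
      along it is \<open>- d\<close>, and adding \<open>d\<close> makes \<open>e\<close> orthogonal
      to every \<open>a l\<close>.\<close>
    define d where "d = (\<lambda>z. \<Sum>l<n. c l * a l z)"
    define e where "e = (\<lambda>z. b z + d z)"
    have da: "kform K U d (a l) = - c l" if "l < n" for l
    proof -
      have "kform K U d (a l) = (\<Sum>l'<n. c l' * kform K U (a l') (a l))"
        unfolding d_def by (rule kform_sum_left)
      also have "\<dots> = (\<Sum>l'<n. if l' = l then - c l' else 0)"
        by (rule sum.cong) (auto simp: orthU that)
      finally show ?thesis using that by simp
    qed
    have ea: "kform K U e (a l) = 0" if "l < n" for l
      using da[OF that] by (simp add: e_def kform_add_left c_def)
    then have ed: "kform K U e d = 0"
      unfolding d_def kform_sum_right by simp
    have "kform K U e e = kform K U e b + kform K U e d"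
      unfolding e_def by (rule kform_add_right)
    also have "\<dots> = kform K U b b + kform K U d b"
      unfolding ed by (simp add: e_def kform_add_left)
    also have "kform K U d b = (\<Sum>l<n. c l * cnj (c l))"
      unfolding d_def kform_sum_left c_def kform_sym[OF K U(2), of b] by simp
    \<comment> \<open>The completed form at \<open>b\<close> is the original form at its orthogonal
      part \<open>e\<close>. So \<open>e\<close> is a negative vector orthogonal to the system and,
      once normalized, extends it.\<close>
    finally have ee: "kform K U e e = kform C U b b" by (simp add: CU)
    have "kform K U e e = cnj (kform K U e e)" by (rule kform_sym[OF K U(2)])
    then have "kform K U e e \<in> \<real>" unfolding Reals_cnj_iff by (rule sym)
    then have eer: "kform K U e e = of_real (Re (kform K U e e))" by simp
    define r where "r = 1 / sqrt (- Re (kform K U e e))"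
    have r: "r * r * Re (kform K U e e) = -1"
      using negU ee by (simp add: r_def)
    define a' where "a' l = (if l < n then a l else (\<lambda>z. of_real r * e z))" for l
    have supp': "e z = 0" if "z \<notin> U" for z
      using that supp by (auto simp: e_def b_def d_def U_def)
    have "negative_system D K (Suc n) U a'"
      unfolding negative_system_def
    proof (intro conjI allI impI)
      fix l l' assume l: "l < Suc n" "l' < Suc n"
      have "of_real r * (of_real r * kform K U e e) = (-1 :: complex)"
        by (subst eer) (use r in \<open>simp add: mult.assoc flip: of_real_mult\<close>)
      moreover have "kform K U (a m) e = 0" if "m < n" for m
        using ea[OF that] kform_sym[OF K U(2), of "a m" e] by simp
      ultimately show "kform K U (a' l) (a' l') = (if l = l' then - 1 else 0)"
        using l orthU ea by (auto simp: a'_def kform_scale_left kform_scale_right less_Suc_eq)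
    next
      fix l z assume "l < Suc n" "z \<notin> U"
      then show "a' l z = 0" using supp supp' U(3) by (auto simp: a'_def)
    qed (use U in auto)
    then have "P (Suc n)" by (auto simp: P_def)
    then have "Suc n \<le> n" unfolding n_def by (rule Greatest_le_nat[of P _ N]) (use Pb in auto)
    then show False by simp
  qed
  then show ?thesis unfolding C_def \<phi>_def by (rule that[OF S])
qed

section \<open>Nevanlinna kernels and their completions\<close>

lemma nev_kernel_hermitian: "nev_kernel f \<zeta> z = cnj (nev_kernel f z \<zeta>)"
proof -
  have "cnj (nev_kernel f z \<zeta>) = (cnj (f z) - f \<zeta>) / (cnj z - \<zeta>)" by (simp add: nev_kernel_def)
  also have "\<dots> = (-(f \<zeta> - cnj (f z))) / (-(\<zeta> - cnj z))" by simp
  also have "\<dots> = nev_kernel f \<zeta> z" unfolding nev_kernel_def minus_divide_divide ..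
  finally show ?thesis by simp
qed

text \<open>The argument of Sylvester's law of inertia. The form is nonnegative on the orthogonal
  complement of \<open>F\<close>, which is cut out by as many equations as there are negative
  eigenvalues; with fewer than \<open>k\<close> equations, a nonzero combination of the system would
  lie there, although the form is negative on it.\<close>

lemma negative_system_le_num_neg_eigenvalues:
  assumes "negative_system D (nev_kernel w) k S a"
  obtains zs where "set zs \<subseteq> D" "k \<le> num_neg_eigenvalues (nev_matrix w zs)"
proof -
  have S: "finite S" "S \<subseteq> D"
    and orth: "\<And>l l'. l < k \<Longrightarrow> l' < k \<Longrightarrow> kform (nev_kernel w) S (a l) (a l') = (if l = l' then -1 else 0)"
    using assms by (auto simp: negative_system_def)
  obtain zs where zs: "set zs = S" "distinct zs" using finite_distinct_list[OF S(1)] by blast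
  define n where "n = length zs"
  define A where "A = nev_matrix w zs"
  have A: "A \<in> carrier_mat n n" and entry: "\<And>i j. i < n \<Longrightarrow> j < n \<Longrightarrow> A $$ (i, j) = nev_kernel w (zs ! j) (zs ! i)"
    by (auto simp: A_def nev_matrix_def n_def)
  define X where "X b = Matrix.vec n (\<lambda>i. b (zs ! i))" for b :: "complex \<Rightarrow> complex"
  have sum_zs: "(\<Sum>i<n. g (zs ! i)) = (\<Sum>z\<in>S. g z)" for g :: "complex \<Rightarrow> complex"
    by (rule sum.reindex_bij_betw) (use bij_betw_nth[OF zs(2)] zs n_def in auto)
  have X: "X b \<in> carrier_vec n" for b by (simp add: X_def)
  have form: "(A *\<^sub>v X b) \<bullet>c X b = kform (nev_kernel w) S b b" for b
  proof -
    have "(A *\<^sub>v X b) \<bullet>c X b = (\<Sum>i<n. (\<Sum>j<n. nev_kernel w (zs ! j) (zs ! i) * b (zs ! j)) * cnj (b (zs ! i)))"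
      using A by (auto simp: scalar_prod_def atLeast0LessThan X_def entry intro!: sum.cong)
    also have "\<dots> = (\<Sum>\<zeta>\<in>S. (\<Sum>z\<in>S. nev_kernel w z \<zeta> * b z) * cnj (b \<zeta>))"
      by (simp only: sum_zs[of "\<lambda>z. nev_kernel w z \<zeta> * b z" for \<zeta>]
        sum_zs[of "\<lambda>\<zeta>. (\<Sum>z\<in>S. nev_kernel w z \<zeta> * b z) * cnj (b \<zeta>)"])
    also have "\<dots> = (\<Sum>\<zeta>\<in>S. \<Sum>z\<in>S. b z * cnj (b \<zeta>) * nev_kernel w z \<zeta>)"
      unfolding sum_distrib_right by (intro sum.cong refl) (simp add: algebra_simps)
    also have "\<dots> = kform (nev_kernel w) S b b" unfolding kform_def by (rule sum.swap)
    finally show ?thesis .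
  qed
  have "\<exists>F. set F \<subseteq> carrier_vec n \<and> length F = num_neg_eigenvalues A \<and>
    (\<forall>x\<in>carrier_vec n. (\<forall>f\<in>set F. x \<bullet>c f = 0) \<longrightarrow> 0 \<le> Re ((A *\<^sub>v x) \<bullet>c x))"
    by (rule hermitian_nonneg_on_small_codim[OF A]) (metis entry nev_kernel_hermitian)
  then obtain F where F: "set F \<subseteq> carrier_vec n" "length F = num_neg_eigenvalues A"
    "\<And>x. x \<in> carrier_vec n \<Longrightarrow> (\<forall>f\<in>set F. x \<bullet>c f = 0) \<Longrightarrow> 0 \<le> Re ((A *\<^sub>v x) \<bullet>c x)"
    by blast
  have "k \<le> length F"
  proof (rule ccontr)
    assume "\<not> k \<le> length F"
    then obtain c where c: "\<exists>l<k. c l \<noteq> 0"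
      "\<And>i. i < length F \<Longrightarrow> (\<Sum>l<k. (X (a l) \<bullet>c (F ! i)) * c l) = 0"
      using exists_nontrivial_homogeneous_solution[of "length F" k "\<lambda>i l. X (a l) \<bullet>c (F ! i)"] by auto
    define b where "b z = (\<Sum>l<k. c l * a l z)" for z
    have "X b \<bullet>c f = 0" if f: "f \<in> set F" for f
    proof -
      from f obtain i where i: "i < length F" "f = F ! i" unfolding in_set_conv_nth by blast
      have fn: "f \<in> carrier_vec n" using f F(1) by auto
      have "X b \<bullet>c f = (\<Sum>j<n. \<Sum>l<k. c l * a l (zs ! j) * cnj (f $ j))"
        using fn by (auto simp: scalar_prod_def atLeast0LessThan X_def b_def sum_distrib_right intro!: sum.cong)
      also have "\<dots> = (\<Sum>l<k. \<Sum>j<n. c l * a l (zs ! j) * cnj (f $ j))" by (rule sum.swap)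
      also have "\<dots> = (\<Sum>l<k. (X (a l) \<bullet>c f) * c l)"
      proof (rule sum.cong[OF refl])
        fix l
        have "(X (a l) \<bullet>c f) = (\<Sum>j<n. a l (zs ! j) * cnj (f $ j))"
          using fn by (auto simp: scalar_prod_def atLeast0LessThan X_def intro!: sum.cong)
        then show "(\<Sum>j<n. c l * a l (zs ! j) * cnj (f $ j)) = (X (a l) \<bullet>c f) * c l"
          by (simp add: sum_distrib_left mult.commute mult.left_commute)
      qed
      finally show ?thesis using c(2)[OF i(1)] i(2) by simp
    qed
    then have "0 \<le> Re (kform (nev_kernel w) S b b)" using F(3)[OF X] form by metis
    moreover have "kform (nev_kernel w) S b b = (\<Sum>l<k. - (c l * cnj (c l)))"
    proof -
      have "kform (nev_kernel w) S b b = (\<Sum>l<k. c l * (\<Sum>l'<k. cnj (c l') * kform (nev_kernel w) S (a l) (a l')))"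
        unfolding b_def kform_sum_left kform_sum_right ..
      also have "\<dots> = (\<Sum>l<k. - (c l * cnj (c l)))"
      proof (rule sum.cong[OF refl])
        fix l assume l: "l \<in> {..<k}"
        have "(\<Sum>l'<k. cnj (c l') * kform (nev_kernel w) S (a l) (a l')) = (\<Sum>l'<k. if l' = l then - cnj (c l') else 0)"
          by (rule sum.cong) (use l orth in auto)
        then show "c l * (\<Sum>l'<k. cnj (c l') * kform (nev_kernel w) S (a l) (a l')) = - (c l * cnj (c l))"
          using l by simp
      qed
      finally show ?thesis .
    qed
    then have "Re (kform (nev_kernel w) S b b) = - (\<Sum>l<k. (cmod (c l))\<^sup>2)"
      by (simp add: complex_norm_square[symmetric] sum_negf del: of_real_power)
    moreover have "0 < (\<Sum>l<k. (cmod (c l))\<^sup>2)"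
    proof -
      obtain l where "l < k" "c l \<noteq> 0" using c(1) by blast
      then show ?thesis by (intro sum_pos2[of _ l]) auto
    qed
    ultimately show False by simp
  qed
  then show ?thesis using that[of zs] S zs F(2) by (auto simp: A_def)
qed

text \<open>\<open>A\<close> and \<open>B\<close> are kept apart from \<open>f\<close> because they
  are to be continuous at the boundary point, where \<open>f\<close> may have no limit.\<close>

definition completed_kernel ::
    "(complex \<Rightarrow> complex) \<Rightarrow> nat \<Rightarrow> (nat \<Rightarrow> complex \<Rightarrow> complex) \<Rightarrow> (nat \<Rightarrow> complex \<Rightarrow> complex) \<Rightarrow> complex \<Rightarrow> complex \<Rightarrow> complex"
  where "completed_kernel f n A B z \<zeta> =
    nev_kernel f z \<zeta> + (\<Sum>l<n. (A l z + B l z * f z) * cnj (A l \<zeta> + B l \<zeta> * f \<zeta>))"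

text \<open>Unlike the number of negative squares, this property visibly passes from \<open>f\<close> to
  \<open>- 1 / f\<close>.\<close>

definition completable :: "real \<Rightarrow> complex set \<Rightarrow> (complex \<Rightarrow> complex) \<Rightarrow> bool"
  where "completable x0 E f \<longleftrightarrow> (\<exists>n A B.
    (\<forall>l<n. isCont (A l) (complex_of_real x0) \<and> isCont (B l) (complex_of_real x0)) \<and>
    psd_kernel E (completed_kernel f n A B))"

lemma psd_kernel_subset: "psd_kernel D K \<Longrightarrow> E \<subseteq> D \<Longrightarrow> psd_kernel E K"
  by (auto simp: psd_kernel_def)

lemma completable_subset: "completable x0 D f \<Longrightarrow> E \<subseteq> D \<Longrightarrow> completable x0 E f"
  unfolding completable_def using psd_kernel_subset by blast

text \<open>For fixed \<open>\<xi>\<close>, \<open>nev_kernel w z \<xi>\<close> is affine in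
  \<open>w z\<close>, with coefficients that are rational in \<open>z\<close> and have their only
  pole at \<open>cnj \<xi>\<close>, in the lower half plane. They are therefore continuous at every
  real point.\<close>

lemma gen_nevanlinna_completable:
  assumes "w \<in> gen_nevanlinna \<kappa>"
  shows "completable x0 (analyticity_domain w) w"
proof -
  let ?D = "analyticity_domain w"
  have le: "num_neg_eigenvalues (nev_matrix w zs) \<le> \<kappa>" if "set zs \<subseteq> ?D" for zs
    using assms that by (auto simp: gen_nevanlinna_def)
  have "hermitian_kernel ?D (nev_kernel w)"
    unfolding hermitian_kernel_def using nev_kernel_hermitian by blast
  moreover have "k \<le> \<kappa>" if ns: "negative_system ?D (nev_kernel w) k S a" for k S a
  proof -
    obtain zs where "set zs \<subseteq> ?D" "k \<le> num_neg_eigenvalues (nev_matrix w zs)"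
      using negative_system_le_num_neg_eigenvalues[OF ns] by blast
    with le show ?thesis by fastforce
  qed
  ultimately obtain n :: nat and S a where S: "finite S" "S \<subseteq> ?D" and psd: "psd_kernel ?D (\<lambda>z \<zeta>. nev_kernel w z \<zeta> +
      (\<Sum>l<n. (\<Sum>\<xi>\<in>S. cnj (a l \<xi>) * nev_kernel w z \<xi>) * cnj (\<Sum>\<xi>\<in>S. cnj (a l \<xi>) * nev_kernel w \<zeta> \<xi>)))"
    by (rule maximal_negative_system_completion)
  define A where "A l z = (\<Sum>\<xi>\<in>S. - cnj (a l \<xi>) * cnj (w \<xi>) / (z - cnj \<xi>))" for l :: nat and z
  define B where "B l z = (\<Sum>\<xi>\<in>S. cnj (a l \<xi>) / (z - cnj \<xi>))" for l :: nat and z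
  have AB: "(\<Sum>\<xi>\<in>S. cnj (a l \<xi>) * nev_kernel w z \<xi>) = A l z + B l z * w z" for l z
  proof -
    have "cnj (a l \<xi>) * nev_kernel w z \<xi> =
        - cnj (a l \<xi>) * cnj (w \<xi>) / (z - cnj \<xi>) + cnj (a l \<xi>) / (z - cnj \<xi>) * w z" for \<xi>
      by (simp add: nev_kernel_def diff_divide_distrib algebra_simps)
    then show ?thesis by (simp only: A_def B_def sum.distrib sum_distrib_right)
  qed
  have "(\<lambda>z \<zeta>. nev_kernel w z \<zeta> + (\<Sum>l<n. (A l z + B l z * w z) * cnj (A l \<zeta> + B l \<zeta> * w \<zeta>))) =
      completed_kernel w n A B"
    by (intro ext) (simp add: completed_kernel_def)
  then have "psd_kernel ?D (completed_kernel w n A B)"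
    using psd unfolding AB by metis
  moreover have "isCont (A l) (complex_of_real x0)" "isCont (B l) (complex_of_real x0)" for l
  proof -
    have "complex_of_real x0 - cnj \<xi> \<noteq> 0" if "\<xi> \<in> S" for \<xi>
    proof -
      have "Im \<xi> > 0" using that S by (auto simp: analyticity_domain_def)
      then show ?thesis by (auto simp: complex_eq_iff)
    qed
    then show "isCont (A l) (complex_of_real x0)" "isCont (B l) (complex_of_real x0)"
      unfolding A_def B_def by (auto intro!: continuous_intros)
  qed
  ultimately show ?thesis unfolding completable_def by blast
qed

text \<open>Both parts of the completed kernel pick up the same factor
  \<open>1 / (f z cnj (f \<zeta>))\<close>: for the finite-rank part,
  \<open>B + (- A) (- 1 / f) = (A + B f) / f\<close>. The factor is absorbed by replacing the
  coefficients \<open>a\<close> by \<open>a / f\<close>.\<close>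

lemma completable_minus_inverse:
  assumes "completable x0 E f" and nz: "\<And>z. z \<in> E \<Longrightarrow> f z \<noteq> 0"
  shows "completable x0 E (\<lambda>z. - 1 / f z)"
proof -
  obtain n A B where cont: "\<forall>l<n. isCont (A l) (complex_of_real x0) \<and> isCont (B l) (complex_of_real x0)"
    and psd: "psd_kernel E (completed_kernel f n A B)"
    using assms(1) unfolding completable_def by blast
  let ?g = "\<lambda>z. - 1 / f z"
  let ?A = "B" and ?B = "\<lambda>l z. - A l z"
  have eq: "completed_kernel ?g n ?A ?B z \<zeta> = completed_kernel f n A B z \<zeta> * (1 / f z) * cnj (1 / f \<zeta>)"
    if "z \<in> E" "\<zeta> \<in> E" for z \<zeta>
  proof -
    have nz': "f z \<noteq> 0" "cnj (f \<zeta>) \<noteq> 0" using nz that by auto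
    have "(?A l z + ?B l z * ?g z) = (A l z + B l z * f z) * (1 / f z)" for l
      using nz' by (simp add: field_simps)
    moreover have "cnj (?A l \<zeta> + ?B l \<zeta> * ?g \<zeta>) = cnj (A l \<zeta> + B l \<zeta> * f \<zeta>) * cnj (1 / f \<zeta>)" for l
      using nz' by (simp add: field_simps)
    ultimately have "(?A l z + ?B l z * ?g z) * cnj (?A l \<zeta> + ?B l \<zeta> * ?g \<zeta>) =
        (A l z + B l z * f z) * cnj (A l \<zeta> + B l \<zeta> * f \<zeta>) * (1 / f z) * cnj (1 / f \<zeta>)" for l
      by (simp only: mult_ac)
    moreover have "nev_kernel ?g z \<zeta> = nev_kernel f z \<zeta> * (1 / f z) * cnj (1 / f \<zeta>)"
    proof -
      have "?g z - cnj (?g \<zeta>) = (f z - cnj (f \<zeta>)) * (1 / f z) * cnj (1 / f \<zeta>)"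
        using nz' by (simp add: field_simps)
      then show ?thesis by (simp add: nev_kernel_def)
    qed
    ultimately show ?thesis
      unfolding completed_kernel_def by (simp only: distrib_right sum_distrib_right)
  qed
  have "psd_kernel E (completed_kernel ?g n ?A ?B)"
    unfolding psd_kernel_def
  proof (intro allI impI)
    fix S a assume S: "finite S \<and> S \<subseteq> E"
    have "kform (completed_kernel ?g n ?A ?B) S a a =
        kform (completed_kernel f n A B) S (\<lambda>z. a z / f z) (\<lambda>z. a z / f z)"
      unfolding kform_def
    proof (intro sum.cong refl)
      fix z \<zeta> assume "z \<in> S" "\<zeta> \<in> S"
      then have "z \<in> E" "\<zeta> \<in> E" using S by auto
      from eq[OF this] show "a z * cnj (a \<zeta>) * completed_kernel ?g n ?A ?B z \<zeta> =
          a z / f z * cnj (a \<zeta> / f \<zeta>) * completed_kernel f n A B z \<zeta>"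
        by simp
    qed
    then show "0 \<le> Re (kform (completed_kernel ?g n ?A ?B) S a a)"
      using psd S by (auto simp: psd_kernel_def)
  qed
  moreover have "\<forall>l<n. isCont (?A l) (complex_of_real x0) \<and> isCont (?B l) (complex_of_real x0)"
    using cont by (auto intro!: continuous_intros)
  ultimately show ?thesis
    unfolding completable_def by (intro exI[of _ n] exI[of _ ?A] exI[of _ ?B] conjI)
qed

lemma completed_kernel_hermitian: "hermitian_kernel D (completed_kernel f n A B)"
  unfolding hermitian_kernel_def completed_kernel_def
proof (intro ballI)
  fix z \<zeta>
  show "nev_kernel f \<zeta> z + (\<Sum>l<n. (A l \<zeta> + B l \<zeta> * f \<zeta>) * cnj (A l z + B l z * f z)) =
    cnj (nev_kernel f z \<zeta> + (\<Sum>l<n. (A l z + B l z * f z) * cnj (A l \<zeta> + B l \<zeta> * f \<zeta>)))"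
    by (subst nev_kernel_hermitian) (simp add: mult.commute)
qed

section \<open>Boundary behaviour along one sequence of bounded kernel values\<close>

lemma nev_kernel_diag: "nev_kernel f z z = of_real (Im (f z) / Im z)"
proof -
  have "f z - cnj (f z) = of_real (Im (f z)) * (2 * \<i>)" "z - cnj z = of_real (Im z) * (2 * \<i>)"
    by (simp_all add: complex_eq_iff)
  then have "nev_kernel f z z = (of_real (Im (f z)) * (2 * \<i>)) / (of_real (Im z) * (2 * \<i>))"
    by (simp only: nev_kernel_def)
  then show ?thesis by simp
qed

lemma eventually_nontangential:
  "eventually P (nontangential x0 D) \<longleftrightarrow>
    (\<forall>a>1. eventually P (at (complex_of_real x0) within (nontangential_region a x0 \<inter> D)))"
  unfolding nontangential_def by (auto simp: eventually_Sup)

lemma filterlim_nontangential: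
  "filterlim h G (nontangential x0 D) \<longleftrightarrow>
    (\<forall>a>1. filterlim h G (at (complex_of_real x0) within (nontangential_region a x0 \<inter> D)))"
  unfolding nontangential_def by (auto simp: filterlim_def filtermap_SUP SUP_le_iff)

text \<open>A general \<open>\<alpha>\<close> allows boundary values to be identified that are not
  yet known to be 0. A constant \<open>M\<close> suffices for boundedness, while an \<open>M\<close>
  tending to the limit inferior gives the sharp limit. As \<open>\<alpha>\<close> is real,
  \<open>K z (\<zeta> k)\<close> tends to the difference quotient \<open>g z\<close>.\<close>

locale boundary_sequence =
  fixes f :: "complex \<Rightarrow> complex" and E :: "complex set" and x0 :: real
    and n :: nat and A B :: "nat \<Rightarrow> complex \<Rightarrow> complex"
    and \<zeta> :: "nat \<Rightarrow> complex" and M :: "nat \<Rightarrow> real" and \<alpha> m :: real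
  assumes E: "E \<subseteq> upper_half_plane"
    and contA: "\<And>l. l < n \<Longrightarrow> isCont (A l) (complex_of_real x0)"
    and contB: "\<And>l. l < n \<Longrightarrow> isCont (B l) (complex_of_real x0)"
    and psd: "psd_kernel E (completed_kernel f n A B)"
    and \<zeta>_in: "\<And>k. \<zeta> k \<in> E" and \<zeta>_lim: "\<zeta> \<longlonglongrightarrow> complex_of_real x0"
    and f_lim: "(\<lambda>k. f (\<zeta> k)) \<longlonglongrightarrow> complex_of_real \<alpha>"
    and M_bound: "\<And>k. Re (nev_kernel f (\<zeta> k) (\<zeta> k)) \<le> M k" and M_lim: "M \<longlonglongrightarrow> m"
begin

abbreviation x :: complex where "x \<equiv> complex_of_real x0"
abbreviation K :: "complex \<Rightarrow> complex \<Rightarrow> complex" where "K \<equiv> nev_kernel f"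
abbreviation C :: "complex \<Rightarrow> complex \<Rightarrow> complex" where "C \<equiv> completed_kernel f n A B"

definition \<phi> :: "nat \<Rightarrow> complex \<Rightarrow> complex" where "\<phi> l z = A l z + B l z * f z"
definition \<phi>0 :: "nat \<Rightarrow> complex" where "\<phi>0 l = A l x + B l x * of_real \<alpha>"
definition r :: "complex \<Rightarrow> real" where "r z = (\<Sum>l<n. (cmod (\<phi> l z))\<^sup>2)"
definition r0 :: real where "r0 = (\<Sum>l<n. (cmod (\<phi>0 l))\<^sup>2)"
definition q :: "complex \<Rightarrow> complex" where "q z = (\<Sum>l<n. \<phi> l z * cnj (\<phi>0 l))"
definition g :: "complex \<Rightarrow> complex" where "g z = (f z - of_real \<alpha>) / (z - x)"
text \<open>In the limit, \<open>g + q\<close> takes the part of the kernel function at the boundary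
  point, and \<open>p\<close> bounds its squared norm.\<close>

definition p :: real where "p = m + r0"

lemma C_eq: "C z u = K z u + (\<Sum>l<n. \<phi> l z * cnj (\<phi> l u))"
  by (simp add: completed_kernel_def \<phi>_def)

lemma C_diag: "Re (C z z) = Re (K z z) + r z"
  by (simp add: C_eq r_def complex_norm_square[symmetric] del: of_real_power)

lemma not_x: "z \<in> E \<Longrightarrow> z \<noteq> x"
  using E by auto

lemma f_eq: "z \<in> E \<Longrightarrow> f z = of_real \<alpha> + (z - x) * g z"
  using not_x by (simp add: g_def)

section \<open>Passage to the limit along the sequence\<close>

lemma \<phi>_lim:
  assumes "l < n" "filterlim u (nhds x) F" "((\<lambda>k. f (u k)) \<longlongrightarrow> of_real \<alpha>) F"
  shows "((\<lambda>k. \<phi> l (u k)) \<longlongrightarrow> \<phi>0 l) F"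
  unfolding \<phi>_def \<phi>0_def
  by (intro tendsto_add tendsto_mult assms(3) isCont_tendsto_compose[OF contA[OF assms(1)] assms(2)]
      isCont_tendsto_compose[OF contB[OF assms(1)] assms(2)])

lemma r_lim:
  assumes "filterlim u (nhds x) F" "((\<lambda>k. f (u k)) \<longlongrightarrow> of_real \<alpha>) F"
  shows "((\<lambda>k. r (u k)) \<longlongrightarrow> r0) F"
  unfolding r_def r0_def using assms by (intro tendsto_intros \<phi>_lim) auto

lemma q_lim:
  assumes "filterlim u (nhds x) F" "((\<lambda>k. f (u k)) \<longlongrightarrow> of_real \<alpha>) F"
  shows "((\<lambda>k. q (u k)) \<longlongrightarrow> of_real r0) F"
proof -
  have "of_real r0 = (\<Sum>l<n. \<phi>0 l * cnj (\<phi>0 l))"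
    by (simp only: r0_def of_real_sum complex_norm_square)
  moreover have "((\<lambda>k. q (u k)) \<longlongrightarrow> (\<Sum>l<n. \<phi>0 l * cnj (\<phi>0 l))) F"
    unfolding q_def using assms by (intro tendsto_intros \<phi>_lim) auto
  ultimately show ?thesis by simp
qed

lemma C_lim:
  assumes "z \<in> E"
  shows "(\<lambda>k. C z (\<zeta> k)) \<longlonglongrightarrow> g z + q z"
proof -
  have "z - cnj x \<noteq> 0" using not_x[OF assms] by simp
  then have "(\<lambda>k. K z (\<zeta> k)) \<longlonglongrightarrow> (f z - cnj (of_real \<alpha>)) / (z - cnj x)"
    unfolding nev_kernel_def by (intro tendsto_intros f_lim \<zeta>_lim)
  moreover have "(\<lambda>k. \<Sum>l<n. \<phi> l z * cnj (\<phi> l (\<zeta> k))) \<longlonglongrightarrow> q z"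
    unfolding q_def by (intro tendsto_intros \<phi>_lim \<zeta>_lim f_lim) auto
  ultimately show ?thesis unfolding C_eq by (intro tendsto_add) (simp_all add: g_def)
qed

lemma diag_lim: "(\<lambda>k. M k + r (\<zeta> k)) \<longlonglongrightarrow> p"
  unfolding p_def by (intro tendsto_intros r_lim M_lim \<zeta>_lim f_lim)

lemma diag_bound: "Re (C (\<zeta> k) (\<zeta> k)) \<le> M k + r (\<zeta> k)"
  using M_bound by (simp add: C_diag)

lemma C_diag_nonneg:
  assumes "z \<in> E"
  shows "0 \<le> Re (C z z)"
proof -
  have "kform C {z} (\<lambda>_. 1) (\<lambda>_. 1) = C z z" by (simp add: kform_def)
  moreover have "0 \<le> Re (kform C {z} (\<lambda>_. 1) (\<lambda>_. 1))"
    using psd assms unfolding psd_kernel_def by blast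
  ultimately show ?thesis by simp
qed

lemma p_nonneg: "0 \<le> p"
  by (rule LIMSEQ_le_const[OF diag_lim])
    (meson C_diag_nonneg \<zeta>_in diag_bound order_trans)

text \<open>The two-point inequality for \<open>z\<close> and \<open>\<zeta> k\<close>, in the
  limit.\<close>

lemma boundary_Cauchy_Schwarz:
  assumes z: "z \<in> E"
  shows "(cmod (g z + q z))\<^sup>2 \<le> (Re (K z z) + r z) * p"
proof (rule LIMSEQ_le)
  show "(\<lambda>k. (cmod (C z (\<zeta> k)))\<^sup>2) \<longlonglongrightarrow> (cmod (g z + q z))\<^sup>2"
    by (intro tendsto_intros C_lim z)
  show "(\<lambda>k. (Re (K z z) + r z) * (M k + r (\<zeta> k))) \<longlonglongrightarrow> (Re (K z z) + r z) * p"
    by (intro tendsto_mult tendsto_const diag_lim)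
  have "(cmod (C z (\<zeta> k)))\<^sup>2 \<le> (Re (K z z) + r z) * (M k + r (\<zeta> k))" for k
  proof -
    have "(cmod (C z (\<zeta> k)))\<^sup>2 \<le> Re (C z z) * Re (C (\<zeta> k) (\<zeta> k))"
      by (rule psd_kernel_two_points[OF completed_kernel_hermitian psd z \<zeta>_in])
    also have "\<dots> \<le> Re (C z z) * (M k + r (\<zeta> k))"
      by (rule mult_left_mono[OF diag_bound C_diag_nonneg[OF z]])
    finally show ?thesis by (simp add: C_diag)
  qed
  then show "\<exists>N. \<forall>k\<ge>N. (cmod (C z (\<zeta> k)))\<^sup>2 \<le> (Re (K z z) + r z) * (M k + r (\<zeta> k))" by blast
qed

text \<open>The three-point inequality in the limit. It makes \<open>C z u\<close> close to its
  boundary counterpart as soon as \<open>u\<close> is close to the boundary point in the norm of the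
  kernel, with a constant depending on \<open>z\<close> only through its diagonal value.\<close>

lemma boundary_Cauchy_Schwarz_diff:
  assumes z: "z \<in> E" and u: "u \<in> E"
  shows "(cmod (C z u - (g z + q z)))\<^sup>2 \<le> (Re (K z z) + r z) * (Re (K u u) + r u - 2 * Re (g u + q u) + p)"
proof (rule LIMSEQ_le)
  show "(\<lambda>k. (cmod (C z u - C z (\<zeta> k)))\<^sup>2) \<longlonglongrightarrow> (cmod (C z u - (g z + q z)))\<^sup>2"
    by (intro tendsto_intros C_lim z)
  show "(\<lambda>k. (Re (K z z) + r z) * (Re (K u u) + r u - 2 * Re (C u (\<zeta> k)) + (M k + r (\<zeta> k))))
      \<longlonglongrightarrow> (Re (K z z) + r z) * (Re (K u u) + r u - 2 * Re (g u + q u) + p)"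
    by (intro tendsto_mult tendsto_const tendsto_add tendsto_diff tendsto_Re diag_lim C_lim u)
  have "(cmod (C z u - C z (\<zeta> k)))\<^sup>2 \<le>
      (Re (K z z) + r z) * (Re (K u u) + r u - 2 * Re (C u (\<zeta> k)) + (M k + r (\<zeta> k)))" for k
  proof -
    have "(cmod (C z u - C z (\<zeta> k)))\<^sup>2 \<le>
        Re (C z z) * (Re (C u u) - 2 * Re (C u (\<zeta> k)) + Re (C (\<zeta> k) (\<zeta> k)))"
      by (rule psd_kernel_three_points[OF completed_kernel_hermitian psd z u \<zeta>_in])
    also have "\<dots> \<le> Re (C z z) * (Re (C u u) - 2 * Re (C u (\<zeta> k)) + (M k + r (\<zeta> k)))"
      by (intro mult_left_mono add_left_mono diag_bound C_diag_nonneg[OF z])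
    finally show ?thesis by (simp add: C_diag)
  qed
  then show "\<exists>N. \<forall>k\<ge>N. (cmod (C z u - C z (\<zeta> k)))\<^sup>2 \<le>
      (Re (K z z) + r z) * (Re (K u u) + r u - 2 * Re (C u (\<zeta> k)) + (M k + r (\<zeta> k)))" by blast
qed

text \<open>The real \<open>\<alpha>\<close> drops out of \<open>Im (f z)\<close>. The second term
  is negligible on nearly vertical approach, where \<open>Re (z - x) / Im z\<close> tends to
  0.\<close>

lemma K_diag_g:
  assumes "z \<in> E"
  shows "Re (K z z) = Re (g z) + Re (z - x) / Im z * Im (g z)"
proof -
  have "Im z > 0" using assms E by auto
  moreover have "Im (f z) = Im z * Re (g z) + Re (z - x) * Im (g z)"
    using f_eq[OF assms] by simp
  ultimately show ?thesis by (simp add: nev_kernel_diag field_simps)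
qed

lemma K_diag_le:
  assumes z: "z \<in> E" "z \<in> nontangential_region a x0"
  shows "Re (K z z) \<le> a * cmod (g z)"
proof -
  have Im: "Im z > 0" and cone: "cmod (z - x) < a * Im z" using z E by (auto simp: nontangential_region_def)
  have "Im (f z) \<le> cmod (f z - of_real \<alpha>)" using abs_Im_le_cmod[of "f z - of_real \<alpha>"] by simp
  also have "\<dots> = cmod (z - x) * cmod (g z)" using f_eq[OF z(1)] by (simp add: norm_mult)
  also have "\<dots> \<le> a * Im z * cmod (g z)" using cone by (intro mult_right_mono) auto
  finally have "Im (f z) / Im z \<le> a * Im z * cmod (g z) / Im z" using Im by (intro divide_right_mono) auto
  then show ?thesis using Im by (simp add: nev_kernel_diag)
qed

text \<open>In \<open>boundary_Cauchy_Schwarz\<close> the left side is quadratic in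
  \<open>y = |g z|\<close>, while \<open>K z z\<close> is at most \<open>a y\<close>. The
  finite-rank terms also grow with \<open>y\<close>, but always through \<open>|z - x| y\<close>,
  because \<open>f z = \<alpha> + (z - x) g z\<close>; close to \<open>x\<close> they are
  absorbed.\<close>

lemma g_bounded:
  assumes a: "1 < a"
  shows "\<exists>G. eventually (\<lambda>z. cmod (g z) \<le> G) (at x within (nontangential_region a x0 \<inter> E))"
proof -
  define s where "s z = (\<Sum>l<n. cmod (A l z + B l z * of_real \<alpha>) + cmod (B l z))" for z
  have "isCont s x" unfolding s_def using contA contB by (intro continuous_intros) auto
  then have s_lim: "(s \<longlongrightarrow> s x) (at x within (nontangential_region a x0 \<inter> E))"
    using isCont_def tendsto_within_subset by blast
  define S where "S = s x + 1"
  have s0: "0 \<le> s z" for z unfolding s_def by (intro sum_nonneg) auto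
  have S0: "0 \<le> S" using s0[of x] by (simp add: S_def)
  define R where "R = (\<Sum>l<n. cmod (\<phi>0 l))"
  have R0: "0 \<le> R" by (simp add: R_def sum_nonneg)
  \<comment> \<open>One constant for both finite-rank terms: \<open>|q z|\<close> is at most
    \<open>S R h\<close> and the root of \<open>r z\<close> at most \<open>(n + 1) S h\<close>,
    where \<open>h = 1 + |z - x| y\<close>. The factor \<open>n + 1\<close> turns a sum of
    \<open>n\<close> squares into a square.\<close>
  define c where "c = S * R + (real n + 1) * S"
  have c0: "0 \<le> c" using S0 R0 by (simp add: c_def)
  define D where "D = c * (1 + sqrt p)"
  have D0: "0 \<le> D" using c0 p_nonneg by (simp add: D_def)
  have bound: "cmod (g z) \<le> 2 * D + 2 * (p * a)"
    if z: "z \<in> nontangential_region a x0" "z \<in> E" and sz: "s z < S" and small: "D * cmod (z - x) \<le> 1 / 4" for z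
  proof -
    define \<tau> y where "\<tau> = cmod (z - x)" and "y = cmod (g z)"
    have ty: "0 \<le> \<tau>" "0 \<le> y" by (auto simp: \<tau>_def y_def)
    define h where "h = 1 + \<tau> * y"
    have h0: "1 \<le> h" using ty by (simp add: h_def)
    have \<phi>le: "cmod (\<phi> l z) \<le> S * h" if l: "l < n" for l
    proof -
      have 1: "cmod (A l z + B l z * of_real \<alpha>) + cmod (B l z) \<le> S"
      proof -
        have "cmod (A l z + B l z * of_real \<alpha>) + cmod (B l z) \<le> s z"
          unfolding s_def by (rule member_le_sum[where i = l]) (use l in auto)
        with sz show ?thesis by simp
      qed
      have "\<phi> l z = (A l z + B l z * of_real \<alpha>) + B l z * ((z - x) * g z)"
        unfolding \<phi>_def by (subst f_eq[OF z(2)]) (simp add: algebra_simps)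
      then have "cmod (\<phi> l z) \<le> cmod (A l z + B l z * of_real \<alpha>) + cmod (B l z) * (\<tau> * y)"
        by (metis norm_mult norm_triangle_ineq \<tau>_def y_def)
      also have "\<dots> \<le> S + S * (\<tau> * y)"
      proof (rule add_mono)
        show "cmod (A l z + B l z * of_real \<alpha>) \<le> S" using 1 norm_ge_zero[of "B l z"] by linarith
        have "cmod (B l z) \<le> S" using 1 norm_ge_zero[of "A l z + B l z * of_real \<alpha>"] by linarith
        then show "cmod (B l z) * (\<tau> * y) \<le> S * (\<tau> * y)" using ty by (intro mult_right_mono) auto
      qed
      finally show ?thesis by (simp add: h_def algebra_simps)
    qed
    have "cmod (q z) \<le> (\<Sum>l<n. S * h * cmod (\<phi>0 l))"
      unfolding q_def by (rule sum_norm_le) (use \<phi>le in \<open>auto simp: norm_mult intro!: mult_right_mono\<close>)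
    also have "\<dots> = S * R * h" by (simp add: R_def sum_distrib_left mult_ac)
    also have "\<dots> \<le> c * h" using S0 h0 by (intro mult_right_mono) (auto simp: c_def)
    finally have ql: "cmod (q z) \<le> c * h" .
    have "r z \<le> (\<Sum>l<n. (S * h)\<^sup>2)"
      unfolding r_def by (intro sum_mono power_mono) (use \<phi>le in auto)
    also have "\<dots> = real n * (S * h)\<^sup>2" by simp
    also have "\<dots> \<le> (real n + 1)\<^sup>2 * (S * h)\<^sup>2"
      by (rule mult_right_mono) (auto simp: power2_eq_square distrib_right)
    also have "\<dots> = ((real n + 1) * S * h)\<^sup>2" by (simp add: power_mult_distrib)
    also have "\<dots> \<le> (c * h)\<^sup>2"
      using S0 R0 h0 by (intro power_mono mult_right_mono) (auto simp: c_def)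
    finally have rl: "r z \<le> (c * h)\<^sup>2" .
    have "(cmod (g z + q z))\<^sup>2 \<le> (a * y + (c * h)\<^sup>2) * p"
      using boundary_Cauchy_Schwarz[OF z(2)] K_diag_le[OF z(2,1)] rl p_nonneg
      by (elim order_trans) (intro mult_right_mono add_mono, auto simp: y_def)
    then have "cmod (g z + q z) \<le> sqrt (p * a * y + (c * h)\<^sup>2 * p)"
      by (intro real_le_rsqrt) (simp add: algebra_simps)
    also have "\<dots> \<le> sqrt (p * a * y) + sqrt ((c * h)\<^sup>2 * p)"
      using p_nonneg a ty by (intro sqrt_add_le_add_sqrt) auto
    also have "sqrt ((c * h)\<^sup>2 * p) = c * h * sqrt p"
      using c0 h0 by (simp add: real_sqrt_mult)
    \<comment> \<open>Arithmetic-geometric mean for \<open>p a\<close> and \<open>y / 4\<close>.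
      Together with the \<open>y / 4\<close> that comes from \<open>D h\<close> below, half of
      \<open>y\<close> remains on the left.\<close>
    also have "sqrt (p * a * y) \<le> p * a + y / 4"
    proof (rule real_le_lsqrt)
      show "p * a * y \<le> (p * a + y / 4)\<^sup>2"
        using zero_le_power2[of "p * a - y / 4"] by (simp add: power2_eq_square algebra_simps)
    qed (use p_nonneg a ty in auto)
    finally have "cmod (g z + q z) \<le> p * a + y / 4 + c * h * sqrt p" by simp
    moreover have "y \<le> cmod (g z + q z) + cmod (q z)"
      using norm_triangle_ineq4[of "g z + q z" "q z"] by (simp add: y_def)
    ultimately have "y \<le> p * a + y / 4 + D * h" using ql by (simp add: D_def algebra_simps)
    moreover have "D * h \<le> D + y / 4"
      using mult_right_mono[OF small, of y] ty by (simp add: h_def \<tau>_def algebra_simps)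
    ultimately show ?thesis by (simp add: y_def)
  qed
  have ev1: "eventually (\<lambda>z. s z < S) (at x within (nontangential_region a x0 \<inter> E))"
    by (rule order_tendstoD(2)[OF s_lim]) (simp add: S_def)
  have "((\<lambda>z. D * cmod (z - x)) \<longlongrightarrow> D * cmod (x - x)) (at x within (nontangential_region a x0 \<inter> E))"
    by (intro tendsto_intros)
  then have ev2: "eventually (\<lambda>z. D * cmod (z - x) < 1 / 4) (at x within (nontangential_region a x0 \<inter> E))"
    by (rule order_tendstoD) auto
  have ev3: "eventually (\<lambda>z. z \<in> nontangential_region a x0 \<inter> E) (at x within (nontangential_region a x0 \<inter> E))"
    by (simp add: eventually_at_filter)
  show ?thesis
    by (intro exI[of _ "2 * D + 2 * (p * a)"] eventually_mono[OF eventually_conj[OF ev1 eventually_conj[OF ev2 ev3]]])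
      (use bound in auto)
qed

text \<open>Even a tangential sequence fixes the nontangential boundary value, since
  \<open>f - \<alpha>\<close> is \<open>z - x\<close> times a bounded function in each
  region.\<close>

lemma f_tendsto:
  assumes a: "1 < a"
  shows "(f \<longlongrightarrow> of_real \<alpha>) (at x within (nontangential_region a x0 \<inter> E))" (is "(_ \<longlongrightarrow> _) ?F")
proof -
  obtain G where G: "eventually (\<lambda>z. cmod (g z) \<le> G) ?F" using g_bounded[OF a] by blast
  have "((\<lambda>z. z - x) \<longlongrightarrow> x - x) ?F" by (intro tendsto_intros)
  then have "((\<lambda>z. cmod (z - x) * G) \<longlongrightarrow> 0) ?F" 
    by (intro tendsto_mult_left_zero tendsto_norm_zero) simp
  then have "((\<lambda>z. (z - x) * g z) \<longlongrightarrow> 0) ?F"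
    by (rule Lim_null_comparison[rotated])
      (use G in \<open>auto simp: norm_mult mult_left_mono elim: eventually_mono\<close>)
  then have "((\<lambda>z. of_real \<alpha> + (z - x) * g z) \<longlongrightarrow> of_real \<alpha> + 0) ?F"
    by (intro tendsto_add tendsto_const)
  moreover have "eventually (\<lambda>z. of_real \<alpha> + (z - x) * g z = f z) ?F"
    using f_eq by (auto simp: eventually_at_filter)
  ultimately show ?thesis using tendsto_cong by fastforce
qed

text \<open>Each \<open>z\<close> is paired with an almost vertical point \<open>u z\<close> at the
  height \<open>s z = |z - x|\<close>. The hypothesis \<open>lower\<close> carries the minimality of
  \<open>m\<close>.\<close>

lemma g_tendsto:
  assumes dense: "\<And>z e. 0 < Im z \<Longrightarrow> 0 < e \<Longrightarrow> \<exists>u\<in>E. dist u z < e"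
    and lower: "\<And>e. 0 < e \<Longrightarrow> eventually (\<lambda>z. m - e < Re (K z z)) (at x within E)"
  shows "(g \<longlongrightarrow> of_real m) (nontangential x0 E)"
  unfolding filterlim_nontangential
proof (intro allI impI)
  fix a :: real assume a: "1 < a"
  define F where "F = at x within (nontangential_region a x0 \<inter> E)"
  define F2 where "F2 = at x within (nontangential_region 2 x0 \<inter> E)"
  have in_F: "eventually (\<lambda>z. z \<in> nontangential_region a x0 \<inter> E) F"
    by (simp add: F_def eventually_at_filter)
  have id_F: "((\<lambda>z. z) \<longlongrightarrow> x) F" unfolding F_def by (rule tendsto_ident_at)
  define s where "s z = cmod (z - x)" for z
  have s_lim: "(s \<longlongrightarrow> 0) F"
    unfolding s_def using tendsto_norm[OF tendsto_diff[OF id_F tendsto_const[of x]]] by simp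
  txt \<open>The vertical ray itself need not lie in \<open>E\<close>.\<close>
  have "\<exists>u\<in>E. dist u (x + \<i> * of_real (s z)) < (s z)\<^sup>2" if "z \<noteq> x" for z
    using that by (intro dense) (auto simp: s_def)
  then obtain u where u: "\<And>z. z \<noteq> x \<Longrightarrow> u z \<in> E \<and> dist (u z) (x + \<i> * of_real (s z)) < (s z)\<^sup>2"
    by metis
  define \<tau> where "\<tau> z = u z - x" for z
  \<comment> \<open>The distance \<open>(s z)^2\<close> to the vertical ray is of smaller order than
    \<open>s z\<close>, so \<open>Re (\<tau> z) / Im (u z)\<close> tends to 0. The factors 3/4 and
    5/4 come from \<open>(s z)^2 < s z / 4\<close>.\<close>
  have near: "Im (u z) > 3 / 4 * s z \<and> cmod (\<tau> z) < 5 / 4 * s z \<and> cmod (\<tau> z) > 3 / 4 * s z \<and>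
      \<bar>Re (\<tau> z)\<bar> \<le> (s z)\<^sup>2 \<and> s z > 0 \<and> u z \<in> nontangential_region 2 x0 \<inter> E"
    if z: "z \<noteq> x" "s z < 1 / 4" for z
  proof -
    have s0: "s z > 0" using z by (simp add: s_def)
    then have s2: "(s z)\<^sup>2 < s z / 4" using z by (simp add: power2_eq_square)
    define d where "d = \<tau> z - \<i> * of_real (s z)"
    have d: "cmod d < (s z)\<^sup>2" using u[OF z(1)] by (simp add: d_def \<tau>_def dist_norm algebra_simps)
    have \<tau>: "\<tau> z = d + \<i> * of_real (s z)" by (simp add: d_def)
    have "\<bar>Im d\<bar> < s z / 4" "\<bar>Re d\<bar> < (s z)\<^sup>2"
      using abs_Im_le_cmod[of d] abs_Re_le_cmod[of d] d s2 by linarith+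
    moreover have "Im (u z) = Im d + s z" "Re (\<tau> z) = Re d" using \<tau> by (simp_all add: \<tau>_def complex_eq_iff)
    ultimately have 1: "Im (u z) > 3 / 4 * s z" "\<bar>Re (\<tau> z)\<bar> \<le> (s z)\<^sup>2" by linarith+
    have "cmod (\<tau> z) \<le> cmod d + cmod (\<i> * of_real (s z))" unfolding \<tau> by (rule norm_triangle_ineq)
    then have 2: "cmod (\<tau> z) < 5 / 4 * s z" using d s2 s0 by (simp add: norm_mult)
    have 3: "cmod (\<tau> z) > 3 / 4 * s z"
      using abs_Im_le_cmod[of "\<tau> z"] 1(1) by (simp add: \<tau>_def)
    show ?thesis using 1 2 3 s0 u[OF z(1)] by (auto simp: nontangential_region_def \<tau>_def)
  qed
  have "eventually (\<lambda>z. s z < 1 / 4) F" by (rule order_tendstoD(2)[OF s_lim]) simp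
  then have "eventually (\<lambda>z. z \<noteq> x \<and> s z < 1 / 4) F"
    using in_F by eventually_elim (use not_x in auto)
  then have near_F: "eventually (\<lambda>z. Im (u z) > 3 / 4 * s z \<and> cmod (\<tau> z) < 5 / 4 * s z \<and> cmod (\<tau> z) > 3 / 4 * s z \<and>
      \<bar>Re (\<tau> z)\<bar> \<le> (s z)\<^sup>2 \<and> s z > 0 \<and> u z \<in> nontangential_region 2 x0 \<inter> E) F"
    by (rule eventually_mono) (use near in blast)
  have \<tau>_lim: "(\<tau> \<longlongrightarrow> 0) F"
  proof (rule Lim_null_comparison)
    show "eventually (\<lambda>z. norm (\<tau> z) \<le> 5 / 4 * s z) F" using near_F by (rule eventually_mono) auto
    show "((\<lambda>z. 5 / 4 * s z) \<longlongrightarrow> 0) F" using tendsto_mult_right_zero[OF s_lim] .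
  qed
  then have u_lim: "(u \<longlongrightarrow> x) F" unfolding \<tau>_def by (simp add: LIM_zero_iff)
  have u_F2: "filterlim u F2 F"
    unfolding F2_def filterlim_at using u_lim near_F not_x by (auto elim: eventually_mono)
  have f_F: "(f \<longlongrightarrow> of_real \<alpha>) F" unfolding F_def by (rule f_tendsto[OF a])
  have f_u: "((\<lambda>z. f (u z)) \<longlongrightarrow> of_real \<alpha>) F"
    using filterlim_compose[OF f_tendsto[of 2] u_F2[unfolded F2_def]] by simp
  obtain G where G: "eventually (\<lambda>z. cmod (g z) \<le> G) F" using g_bounded[OF a] unfolding F_def by blast
  obtain G2 where "eventually (\<lambda>z. cmod (g z) \<le> G2) F2" using g_bounded[of 2] unfolding F2_def by auto
  then have Gu: "eventually (\<lambda>z. cmod (g (u z)) \<le> G2) F"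
    by (rule eventually_compose_filterlim[OF _ u_F2])
  define k where "k z = Re (K (u z) (u z))" for z
  \<comment> \<open>Minimality controls \<open>k\<close> only from below, so just the positive part
    of \<open>m - k\<close> is known to vanish at this stage.\<close>
  have k_lower: "((\<lambda>z. max 0 (m - k z)) \<longlongrightarrow> 0) F"
  proof (rule order_tendstoI)
    fix e :: real assume "e < 0"
    then show "eventually (\<lambda>z. e < max 0 (m - k z)) F" by (intro always_eventually) auto
  next
    fix e :: real assume e: "0 < e"
    have "filterlim u (at x within E) F"
      unfolding filterlim_at using u_lim near_F not_x by (auto elim: eventually_mono)
    with lower[OF e] have "eventually (\<lambda>z. m - e < k z) F"
      unfolding k_def by (rule eventually_compose_filterlim)
    then show "eventually (\<lambda>z. max 0 (m - k z) < e) F"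
      by (rule eventually_mono) (use e in auto)
  qed
  have k_g: "((\<lambda>z. k z - Re (g (u z))) \<longlongrightarrow> 0) F"
  proof (rule Lim_null_comparison)
    show "((\<lambda>z. 4 / 3 * G2 * s z) \<longlongrightarrow> 0) F" using tendsto_mult_right_zero[OF s_lim] .
    show "eventually (\<lambda>z. norm (k z - Re (g (u z))) \<le> 4 / 3 * G2 * s z) F"
      using near_F Gu
    proof eventually_elim
      case (elim z)
      then have uE: "u z \<in> E" and s0: "s z > 0" by auto
      have "norm (k z - Re (g (u z))) = \<bar>Re (\<tau> z)\<bar> / \<bar>Im (u z)\<bar> * \<bar>Im (g (u z))\<bar>"
        using K_diag_g[OF uE] by (simp add: k_def \<tau>_def abs_mult)
      also have "\<dots> \<le> (s z)\<^sup>2 / (3 / 4 * s z) * G2"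
        using elim abs_Im_le_cmod[of "g (u z)"]
        by (intro mult_mono frac_le) auto
      also have "\<dots> = 4 / 3 * G2 * s z" using s0 by (simp add: power2_eq_square)
      finally show ?case .
    qed
  qed
  have r_u: "((\<lambda>z. r (u z)) \<longlongrightarrow> r0) F" and q_u: "((\<lambda>z. q (u z)) \<longlongrightarrow> of_real r0) F"
    by (rule r_lim[OF u_lim f_u] q_lim[OF u_lim f_u])+
  have Re_q_u: "((\<lambda>z. Re (q (u z))) \<longlongrightarrow> r0) F" using tendsto_Re[OF q_u] by simp
  have P_u: "((\<lambda>z. g (u z) + q (u z) - of_real p) \<longlongrightarrow> 0) F"
  proof -
    \<comment> \<open>With \<open>P = g (u z) + q (u z)\<close>, expanding \<open>|P - p|^2\<close>
      and bounding \<open>|P|^2\<close> by Cauchy-Schwarz leaves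
      \<open>p (k + r - 2 Re P + p)\<close>. Since \<open>p = m + r0\<close>, the bracket regroups
      into null terms and \<open>m - k\<close>, which minimality bounds from above.\<close>
    define h where "h z = p * (2 * (k z - Re (g (u z))) + (r (u z) - Re (q (u z))) + (r0 - Re (q (u z))) + max 0 (m - k z))" for z
    have "(h \<longlongrightarrow> p * (2 * 0 + (r0 - r0) + (r0 - r0) + 0)) F"
      unfolding h_def by (intro tendsto_intros k_g r_u Re_q_u k_lower)
    then have "(h \<longlongrightarrow> 0) F" by simp
    from tendsto_real_sqrt[OF this] have "((\<lambda>z. sqrt (h z)) \<longlongrightarrow> 0) F" by simp
    moreover have "eventually (\<lambda>z. norm (g (u z) + q (u z) - of_real p) \<le> sqrt (h z)) F"
      using near_F
    proof eventually_elim
      case (elim z)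
      define P where "P = g (u z) + q (u z)"
      have "(cmod P)\<^sup>2 \<le> (k z + r (u z)) * p"
        using boundary_Cauchy_Schwarz[of "u z"] elim by (simp add: P_def k_def)
      moreover have "(cmod (P - of_real p))\<^sup>2 = (cmod P)\<^sup>2 - 2 * p * Re P + p\<^sup>2"
        unfolding cmod_power2 by (simp add: power2_eq_square algebra_simps)
      ultimately have "(cmod (P - of_real p))\<^sup>2 \<le> p * (k z + r (u z) - 2 * Re P + p)"
        by (simp add: power2_eq_square algebra_simps)
      also have "\<dots> \<le> h z"
      proof -
        have "m - k z \<le> max 0 (m - k z)" by (rule max.cobounded2)
        moreover have "Re P = Re (g (u z)) + Re (q (u z))" by (simp add: P_def)
        ultimately have "k z + r (u z) - 2 * Re P + p \<le>
            2 * (k z - Re (g (u z))) + (r (u z) - Re (q (u z))) + (r0 - Re (q (u z))) + max 0 (m - k z)"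
          unfolding p_def by argo
        then show ?thesis unfolding h_def by (rule mult_left_mono[OF _ p_nonneg])
      qed
      finally show ?case unfolding P_def by (rule real_le_rsqrt)
    qed
    ultimately show ?thesis by (rule Lim_null_comparison[rotated])
  qed
  have g_u: "((\<lambda>z. g (u z)) \<longlongrightarrow> of_real m) F"
  proof -
    have "((\<lambda>z. (g (u z) + q (u z) - of_real p) - q (u z) + of_real p) \<longlongrightarrow> 0 - of_real r0 + of_real p) F"
      by (intro tendsto_intros P_u q_u)
    then show ?thesis by (simp add: p_def)
  qed
  have "((\<lambda>z. k z - Re (g (u z)) + Re (g (u z))) \<longlongrightarrow> 0 + Re (of_real m)) F"
    by (intro tendsto_add k_g tendsto_Re g_u)
  then have k_lim: "(k \<longlongrightarrow> m) F" by simp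
  \<comment> \<open>The factor belonging to \<open>z\<close> stays bounded by the bound on
    \<open>g\<close>; the factor belonging to \<open>u z\<close> tends to
    \<open>m + r0 - 2 (m + r0) + p = 0\<close>.\<close>
  have diff: "((\<lambda>z. C z (u z) - (g z + q z)) \<longlongrightarrow> 0) F"
  proof -
    define h where "h z = (a * \<bar>G\<bar> + r z) * \<bar>k z + r (u z) - 2 * Re (g (u z) + q (u z)) + p\<bar>" for z
    have "(h \<longlongrightarrow> (a * \<bar>G\<bar> + r0) * \<bar>m + r0 - 2 * Re (of_real m + of_real r0) + p\<bar>) F"
      unfolding h_def by (intro tendsto_intros k_lim r_u g_u q_u r_lim[OF id_F f_F])
    then have "(h \<longlongrightarrow> 0) F" by (simp add: p_def)
    from tendsto_real_sqrt[OF this] have "((\<lambda>z. sqrt (h z)) \<longlongrightarrow> 0) F" by simp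
    moreover have "eventually (\<lambda>z. norm (C z (u z) - (g z + q z)) \<le> sqrt (h z)) F"
      using near_F in_F G
    proof eventually_elim
      case (elim z)
      have zE: "z \<in> E" "z \<in> nontangential_region a x0" and uE: "u z \<in> E" using elim by auto
      have "(cmod (C z (u z) - (g z + q z)))\<^sup>2 \<le>
          (Re (K z z) + r z) * (k z + r (u z) - 2 * Re (g (u z) + q (u z)) + p)"
        using boundary_Cauchy_Schwarz_diff[OF zE(1) uE] by (simp add: k_def)
      also have "\<dots> \<le> (Re (K z z) + r z) * \<bar>k z + r (u z) - 2 * Re (g (u z) + q (u z)) + p\<bar>"
        using C_diag_nonneg[OF zE(1)] by (intro mult_left_mono) (auto simp: C_diag)
      also have "\<dots> \<le> h z"
      proof -
        have "Re (K z z) \<le> a * cmod (g z)" by (rule K_diag_le[OF zE])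
        also have "\<dots> \<le> a * \<bar>G\<bar>" using elim a by (intro mult_left_mono) auto
        finally show ?thesis unfolding h_def by (intro mult_right_mono) auto
      qed
      finally show ?case by (rule real_le_rsqrt)
    qed
    ultimately show ?thesis by (rule Lim_null_comparison[rotated])
  qed
  have K_g: "((\<lambda>z. K z (u z) - g z) \<longlongrightarrow> 0) F"
  proof -
    have "((\<lambda>z. (C z (u z) - (g z + q z)) - (\<Sum>l<n. \<phi> l z * cnj (\<phi> l (u z))) + q z)
        \<longlongrightarrow> 0 - (\<Sum>l<n. \<phi>0 l * cnj (\<phi>0 l)) + of_real r0) F"
      by (intro tendsto_intros diff \<phi>_lim id_F f_F u_lim f_u q_lim) auto
    moreover have "of_real r0 = (\<Sum>l<n. \<phi>0 l * cnj (\<phi>0 l))"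
      by (simp only: r0_def of_real_sum complex_norm_square)
    ultimately show ?thesis by (simp add: C_eq)
  qed
  \<comment> \<open>\<open>(K z (u z) - g z) (t - cnj (\<tau> z)) = cnj (\<tau> z) (g z - cnj (g (u
    z)))\<close>, and \<open>\<tau> z\<close> may be cancelled because \<open>|t|\<close> and
    \<open>|\<tau> z|\<close> are comparable. This is why \<open>u z\<close> is placed at the height
    \<open>|z - x|\<close>.\<close>
  have g_diff: "((\<lambda>z. g z - cnj (g (u z))) \<longlongrightarrow> 0) F"
  proof (rule Lim_null_comparison)
    show "((\<lambda>z. 3 * cmod (K z (u z) - g z)) \<longlongrightarrow> 0) F"
      using tendsto_mult_right_zero[OF tendsto_norm_zero[OF K_g]] .
    show "eventually (\<lambda>z. norm (g z - cnj (g (u z))) \<le> 3 * cmod (K z (u z) - g z)) F"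
      using near_F in_F
    proof eventually_elim
      case (elim z)
      have zE: "z \<in> E" and uE: "u z \<in> E" using elim by auto
      define t where "t = z - x"
      have "Im t > 0" "Im (\<tau> z) > 0" using zE uE E by (auto simp: t_def \<tau>_def)
      then have nz: "t - cnj (\<tau> z) \<noteq> 0" by (auto simp: complex_eq_iff)
      have "f z - cnj (f (u z)) = t * g z - cnj (\<tau> z) * cnj (g (u z))"
        using f_eq[OF zE] f_eq[OF uE] by (simp add: t_def \<tau>_def)
      moreover have "z - cnj (u z) = t - cnj (\<tau> z)" by (simp add: t_def \<tau>_def)
      ultimately have "K z (u z) * (t - cnj (\<tau> z)) = t * g z - cnj (\<tau> z) * cnj (g (u z))"
        using nz by (simp add: nev_kernel_def)
      then have "(K z (u z) - g z) * (t - cnj (\<tau> z)) = cnj (\<tau> z) * (g z - cnj (g (u z)))"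
        by (simp add: algebra_simps)
      then have "cmod (K z (u z) - g z) * cmod (t - cnj (\<tau> z)) = cmod (\<tau> z) * cmod (g z - cnj (g (u z)))"
        by (metis complex_mod_cnj norm_mult)
      moreover have "cmod (t - cnj (\<tau> z)) \<le> 3 * cmod (\<tau> z)"
      proof -
        have "cmod (t - cnj (\<tau> z)) \<le> s z + cmod (\<tau> z)"
          using norm_triangle_ineq4[of t "cnj (\<tau> z)"] by (simp add: t_def s_def)
        then show ?thesis using elim by linarith
      qed
      ultimately have "cmod (\<tau> z) * cmod (g z - cnj (g (u z))) \<le> cmod (\<tau> z) * (3 * cmod (K z (u z) - g z))"
        using mult_left_mono[of "cmod (t - cnj (\<tau> z))" "3 * cmod (\<tau> z)" "cmod (K z (u z) - g z)"]
        by (simp add: mult_ac)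
      moreover have "cmod (\<tau> z) > 0" using elim by linarith
      ultimately show ?case by simp
    qed
  qed
  have "((\<lambda>z. (g z - cnj (g (u z))) + cnj (g (u z))) \<longlongrightarrow> 0 + cnj (of_real m)) F"
    by (intro tendsto_intros g_diff g_u)
  then show "(g \<longlongrightarrow> of_real m) (at x within (nontangential_region a x0 \<inter> E))"
    by (simp add: F_def)
qed

end

section \<open>Limits inferior and nontangential limits\<close>

lemma completed_kernel_diag_lower:
  assumes "psd_kernel E (completed_kernel f n A B)" "z \<in> E"
  shows "- (\<Sum>l<n. (cmod (A l z + B l z * f z))\<^sup>2) \<le> Re (nev_kernel f z z)"
proof -
  let ?C = "completed_kernel f n A B"
  have "kform ?C {z} (\<lambda>_. 1) (\<lambda>_. 1) = ?C z z" by (simp add: kform_def)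
  moreover have "0 \<le> Re (kform ?C {z} (\<lambda>_. 1) (\<lambda>_. 1))"
    using assms unfolding psd_kernel_def by blast
  moreover have "Re (?C z z) = Re (nev_kernel f z z) + (\<Sum>l<n. (cmod (A l z + B l z * f z))\<^sup>2)"
    by (simp only: completed_kernel_def complex_norm_square[symmetric] of_real_sum[symmetric]
        plus_complex.sel Re_complex_of_real)
  ultimately show ?thesis by simp
qed

text \<open>The finite-rank part converges where \<open>f\<close> does, and the diagonal of the
  completed kernel is nonnegative.\<close>

lemma nev_kernel_diag_bounded_below:
  assumes "completable x0 E f" and \<zeta>: "\<And>k. \<zeta> k \<in> E" "\<zeta> \<longlonglongrightarrow> complex_of_real x0"
    and f: "(\<lambda>k. f (\<zeta> k)) \<longlonglongrightarrow> \<alpha>"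
  shows "\<exists>c. \<forall>k. - c \<le> Re (nev_kernel f (\<zeta> k) (\<zeta> k))"
proof -
  obtain n A B where cont: "\<And>l. l < n \<Longrightarrow> isCont (A l) (complex_of_real x0)"
      "\<And>l. l < n \<Longrightarrow> isCont (B l) (complex_of_real x0)"
    and psd: "psd_kernel E (completed_kernel f n A B)"
    using assms(1) unfolding completable_def by blast
  have "(\<lambda>k. A l (\<zeta> k) + B l (\<zeta> k) * f (\<zeta> k)) \<longlonglongrightarrow> A l x0 + B l x0 * \<alpha>" if "l < n" for l
    by (intro tendsto_add tendsto_mult f isCont_tendsto_compose[OF cont(1)[OF that] \<zeta>(2)]
        isCont_tendsto_compose[OF cont(2)[OF that] \<zeta>(2)])
  then have "(\<lambda>k. \<Sum>l<n. (cmod (A l (\<zeta> k) + B l (\<zeta> k) * f (\<zeta> k)))\<^sup>2)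
      \<longlonglongrightarrow> (\<Sum>l<n. (cmod (A l x0 + B l x0 * \<alpha>))\<^sup>2)" (is "?r \<longlonglongrightarrow> _")
    by (intro tendsto_sum tendsto_power tendsto_norm) auto
  then have "Bseq ?r" using convergentI convergent_imp_Bseq by blast
  then obtain c where c: "\<And>k. norm (?r k) \<le> c" by (auto simp: Bseq_def)
  have "- c \<le> Re (nev_kernel f (\<zeta> k) (\<zeta> k))" for k
    using c[of k] completed_kernel_diag_lower[OF psd \<zeta>(1), of k] by auto
  then show ?thesis by blast
qed

text \<open>Bounded values of \<open>Im f / Im z\<close> along a sequence tending to the real axis
  force \<open>Im f\<close> to 0. Hence \<open>\<alpha>\<close> is real, as
  \<open>boundary_sequence\<close> requires.\<close>

lemma nontangential_boundary_value:
  assumes E: "E \<subseteq> upper_half_plane" and f: "completable x0 E f"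
    and \<zeta>: "\<And>k. \<zeta> k \<in> E" "\<zeta> \<longlonglongrightarrow> complex_of_real x0"
    and f_lim: "(\<lambda>k. f (\<zeta> k)) \<longlonglongrightarrow> \<alpha>"
    and M: "\<And>k. Re (nev_kernel f (\<zeta> k) (\<zeta> k)) \<le> M"
  shows "(f \<longlongrightarrow> \<alpha>) (nontangential x0 E)"
proof -
  obtain n A B where cont: "\<And>l. l < n \<Longrightarrow> isCont (A l) (complex_of_real x0)"
      "\<And>l. l < n \<Longrightarrow> isCont (B l) (complex_of_real x0)"
    and psd: "psd_kernel E (completed_kernel f n A B)"
    using f unfolding completable_def by blast
  obtain c where c: "\<And>k. - c \<le> Re (nev_kernel f (\<zeta> k) (\<zeta> k))"
    using nev_kernel_diag_bounded_below[OF f \<zeta> f_lim] by blast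
  have "(\<lambda>k. Im (f (\<zeta> k))) \<longlonglongrightarrow> 0"
  proof (rule Lim_null_comparison)
    show "\<forall>\<^sub>F k in sequentially. norm (Im (f (\<zeta> k))) \<le> (\<bar>c\<bar> + \<bar>M\<bar>) * Im (\<zeta> k)"
    proof (intro always_eventually allI)
      fix k
      have Im: "Im (\<zeta> k) > 0" using \<zeta>(1)[of k] E by auto
      have "\<bar>Im (f (\<zeta> k)) / Im (\<zeta> k)\<bar> \<le> \<bar>c\<bar> + \<bar>M\<bar>"
        using c[of k] M[of k] by (simp add: nev_kernel_diag)
      then show "norm (Im (f (\<zeta> k))) \<le> (\<bar>c\<bar> + \<bar>M\<bar>) * Im (\<zeta> k)"
        using Im by (simp add: abs_divide field_simps)
    qed
    show "(\<lambda>k. (\<bar>c\<bar> + \<bar>M\<bar>) * Im (\<zeta> k)) \<longlonglongrightarrow> 0"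
      using tendsto_mult[OF tendsto_const[of "\<bar>c\<bar> + \<bar>M\<bar>"] tendsto_Im[OF \<zeta>(2)]] by simp
  qed
  then have "Im \<alpha> = 0" using tendsto_Im[OF f_lim] LIMSEQ_unique by blast
  then have \<alpha>: "\<alpha> = of_real (Re \<alpha>)" by (simp add: complex_eq_iff)
  interpret boundary_sequence f E x0 n A B \<zeta> "\<lambda>_. M" "Re \<alpha>" M
    by unfold_locales (use E cont psd \<zeta> f_lim \<alpha> M in auto)
  show ?thesis unfolding filterlim_nontangential using f_tendsto \<alpha> by simp
qed

section \<open>Sequences that realize the limit inferior\<close>

lemma infinite_bounded_subsequence:
  fixes h :: "nat \<Rightarrow> complex"
  assumes "infinite {k. cmod (h k) \<le> 1}"
  obtains \<sigma> \<alpha> where "strict_mono \<sigma>" "(\<lambda>k. h (\<sigma> k)) \<longlonglongrightarrow> \<alpha>" "\<And>k. cmod (h (\<sigma> k)) \<le> 1"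
proof -
  define e where "e = enumerate {k. cmod (h k) \<le> 1}"
  have e: "strict_mono e" "\<And>k. cmod (h (e k)) \<le> 1"
    using assms enumerate_in_set[OF assms] by (auto simp: e_def strict_mono_enumerate)
  have "\<forall>k. h (e k) \<in> cball 0 1" using e(2) by simp
  then obtain \<alpha> \<sigma> where "strict_mono \<sigma>" "((h \<circ> e) \<circ> \<sigma>) \<longlonglongrightarrow> \<alpha>"
    using compact_imp_seq_compact[OF compact_cball[of "0::complex" 1]]
    unfolding seq_compact_def by (metis comp_apply)
  then show ?thesis
    using that[of "e \<circ> \<sigma>" \<alpha>] e by (auto simp: o_def strict_mono_def)
qed

lemma frequently_at_sequence:
  fixes x :: complex
  assumes "\<And>k :: nat. frequently (P k) (at x within E)"
  obtains \<zeta> where "\<And>k. \<zeta> k \<in> E" "\<And>k. P k (\<zeta> k)" "\<zeta> \<longlonglongrightarrow> x"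
proof -
  have "\<exists>z\<in>E. dist z x < 1 / real (Suc k) \<and> P k z" for k
    using assms[of k] unfolding frequently_at by (metis of_nat_0_less_iff zero_less_Suc zero_less_divide_1_iff)
  then obtain \<zeta> where \<zeta>: "\<And>k. \<zeta> k \<in> E \<and> dist (\<zeta> k) x < 1 / real (Suc k) \<and> P k (\<zeta> k)" by metis
  have "(\<lambda>k. dist (\<zeta> k) x) \<longlonglongrightarrow> 0"
  proof (rule tendsto_sandwich[OF _ _ tendsto_const])
    show "(\<lambda>k. 1 / real (Suc k)) \<longlonglongrightarrow> 0" using LIMSEQ_inverse_real_of_nat by (simp add: inverse_eq_divide)
  qed (use \<zeta> less_imp_le in \<open>auto intro!: always_eventually\<close>)
  then have "\<zeta> \<longlonglongrightarrow> x" by (rule tendsto_dist_iff[THEN iffD2])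
  with \<zeta> that show ?thesis by blast
qed

lemma nontangential_nontrivial:
  assumes E: "E \<subseteq> upper_half_plane" and dense: "\<And>z e. 0 < Im z \<Longrightarrow> 0 < e \<Longrightarrow> \<exists>u\<in>E. dist u z < e"
  shows "nontangential x0 E \<noteq> bot"
proof
  let ?x = "complex_of_real x0"
  assume "nontangential x0 E = bot"
  then have "eventually (\<lambda>_. False) (at ?x within (nontangential_region 2 x0 \<inter> E))"
    using eventually_nontangential[of "\<lambda>_. False" x0 E] by simp
  then obtain d where d: "d > 0" "\<And>u. u \<in> nontangential_region 2 x0 \<Longrightarrow> u \<in> E \<Longrightarrow> u \<noteq> ?x \<Longrightarrow> \<not> dist u ?x < d"
    unfolding eventually_at by auto
  \<comment> \<open>An error below \<open>d / 8\<close> leaves height above \<open>3 d / 8\<close>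
    and modulus below \<open>5 d / 8\<close>, which meets the aperture 2.\<close>
  have "\<exists>u\<in>E. dist u (?x + \<i> * of_real (d / 2)) < d / 8" by (rule dense) (use d in auto)
  then obtain u where u: "u \<in> E" "cmod (u - (?x + \<i> * of_real (d / 2))) < d / 8" by (auto simp: dist_norm)
  define e where "e = u - (?x + \<i> * of_real (d / 2))"
  have ue: "u - ?x = e + \<i> * of_real (d / 2)" "cmod e < d / 8" using u(2) by (simp_all add: e_def)
  have "Im u = Im e + d / 2" using arg_cong[OF ue(1), of Im] by simp
  then have Im: "Im u > 3 / 8 * d" using abs_Im_le_cmod[of e] ue(2) by linarith
  have "cmod (u - ?x) \<le> cmod e + cmod (\<i> * of_real (d / 2))" unfolding ue(1) by (rule norm_triangle_ineq)
  then have norm: "cmod (u - ?x) < 5 / 8 * d" using ue(2) d(1) by (simp add: norm_mult)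
  have "u \<in> nontangential_region 2 x0" using Im norm d(1) by (auto simp: nontangential_region_def)
  moreover have "u \<noteq> ?x" using u(1) E by auto
  ultimately have "\<not> dist u ?x < d" using d(2) u(1) by blast
  then show False using norm d(1) by (simp add: dist_norm)
qed

text \<open>At each point \<open>|v|\<close> or \<open>|w|\<close> is at most 1, so one of them
  converges along a subsequence. A limit of \<open>v\<close> must agree with its nontangential limit
  0; a limit of \<open>w\<close> would be a finite nontangential limit of \<open>w\<close>.\<close>

lemma subsequence_tendsto_zero:
  assumes E: "E \<subseteq> upper_half_plane" and dense: "\<And>z e. 0 < Im z \<Longrightarrow> 0 < e \<Longrightarrow> \<exists>u\<in>E. dist u z < e"
    and nz: "\<And>z. z \<in> E \<Longrightarrow> w z \<noteq> 0"
    and w: "completable x0 E w"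
    and inf: "filterlim (\<lambda>z. cmod (w z)) at_top (nontangential x0 E)"
    and \<zeta>: "\<And>k. \<zeta> k \<in> E" "\<zeta> \<longlonglongrightarrow> complex_of_real x0"
    and M: "\<And>k. Re (nev_kernel (\<lambda>z. - 1 / w z) (\<zeta> k) (\<zeta> k)) \<le> M"
  obtains \<sigma> where "strict_mono \<sigma>" "(\<lambda>k. - 1 / w (\<zeta> (\<sigma> k))) \<longlonglongrightarrow> 0"
proof -
  define v where "v z = - 1 / w z" for z
  let ?F = "nontangential x0 E"
  have v: "completable x0 E v" unfolding v_def by (rule completable_minus_inverse[OF w nz])
  have nontriv: "?F \<noteq> bot" by (rule nontangential_nontrivial[OF E dense])
  have w_inf: "filterlim w at_infinity ?F" using inf by (rule filterlim_norm_at_top_imp_at_infinity)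
  have v0: "(v \<longlongrightarrow> 0) ?F"
    using tendsto_divide_0[OF tendsto_const w_inf, of "-1"] by (simp add: v_def[abs_def])
  have sub: "(\<lambda>k. \<zeta> (\<sigma> k)) \<longlonglongrightarrow> complex_of_real x0" if "strict_mono \<sigma>" for \<sigma>
    using LIMSEQ_subseq_LIMSEQ[OF \<zeta>(2) that] by (simp add: o_def)
  show ?thesis
  proof (cases "infinite {k. cmod (v (\<zeta> k)) \<le> 1}")
    case True
    then obtain \<sigma> \<alpha> where \<sigma>: "strict_mono \<sigma>" "(\<lambda>k. v (\<zeta> (\<sigma> k))) \<longlonglongrightarrow> \<alpha>"
      by (rule infinite_bounded_subsequence)
    have "(v \<longlongrightarrow> \<alpha>) ?F"
      by (rule nontangential_boundary_value[OF E v _ sub[OF \<sigma>(1)] \<sigma>(2), of M])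
        (use \<zeta> M in \<open>auto simp: v_def[abs_def]\<close>)
    then have "\<alpha> = 0" using tendsto_unique[OF nontriv _ v0] by blast
    with \<sigma> that show ?thesis by (simp add: v_def)
  next
    case False
    have "UNIV = {k. cmod (v (\<zeta> k)) \<le> 1} \<union> {k. cmod (w (\<zeta> k)) \<le> 1}"
    proof -
      have "cmod (w (\<zeta> k)) \<le> 1" if "\<not> cmod (v (\<zeta> k)) \<le> 1" for k
        using that nz[OF \<zeta>(1)[of k]] by (simp add: v_def norm_divide field_simps)
      then show ?thesis by auto
    qed
    then have "infinite {k. cmod (w (\<zeta> k)) \<le> 1}"
      using False by (metis finite_Un infinite_UNIV_nat)
    then obtain \<sigma> \<beta> where \<sigma>: "strict_mono \<sigma>" "(\<lambda>k. w (\<zeta> (\<sigma> k))) \<longlonglongrightarrow> \<beta>" "\<And>k. cmod (w (\<zeta> (\<sigma> k))) \<le> 1"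
      using infinite_bounded_subsequence[of "\<lambda>k. w (\<zeta> k)"] by blast
    \<comment> \<open>On the diagonal \<open>K_w = |w|^2 K_v\<close>, so \<open>|w| \<le> 1\<close>
      transfers the bound from \<open>v\<close> to \<open>w\<close>.\<close>
    have "Re (nev_kernel w (\<zeta> (\<sigma> k)) (\<zeta> (\<sigma> k))) \<le> \<bar>M\<bar>" for k
    proof -
      define z where "z = \<zeta> (\<sigma> k)"
      have "w z \<noteq> 0" "Im z > 0" using nz[OF \<zeta>(1)] \<zeta>(1)[of "\<sigma> k"] E by (auto simp: z_def)
      have wz: "cmod (w z) \<noteq> 0" using \<open>w z \<noteq> 0\<close> by simp
      have "Im (v z) = Im (w z) / (cmod (w z))\<^sup>2" by (simp add: v_def Im_divide cmod_power2)
      then have "Im (w z) = (cmod (w z))\<^sup>2 * Im (v z)" using wz by simp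
      then have "Im (w z) / Im z = (cmod (w z))\<^sup>2 * (Im (v z) / Im z)" by simp
      also have "\<dots> \<le> (cmod (w z))\<^sup>2 * \<bar>M\<bar>"
        using M[of "\<sigma> k"] by (intro mult_left_mono) (auto simp: nev_kernel_diag z_def v_def)
      also have "\<dots> \<le> 1 * \<bar>M\<bar>"
        using \<sigma>(3)[of k] by (intro mult_right_mono) (auto simp: z_def abs_square_le_1)
      finally show ?thesis by (simp add: nev_kernel_diag z_def)
    qed
    then have "(w \<longlongrightarrow> \<beta>) ?F"
      by (intro nontangential_boundary_value[OF E w _ sub[OF \<sigma>(1)] \<sigma>(2)]) (use \<zeta> in auto)
    then show ?thesis using not_tendsto_and_filterlim_at_infinity[OF nontriv _ w_inf] by blast
  qed
qed

text \<open>Assuming only that the limit inferior is not \<open>\<infinity>\<close> lets the lemma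
  serve the converse direction too, where a nontangential limit merely bounds it from above.\<close>

lemma Liminf_nev_kernel_imp_nontangential_limit:
  fixes x0 :: real
  assumes E: "E \<subseteq> upper_half_plane" and dense: "\<And>z e. 0 < Im z \<Longrightarrow> 0 < e \<Longrightarrow> \<exists>u\<in>E. dist u z < e"
    and nz: "\<And>z. z \<in> E \<Longrightarrow> w z \<noteq> 0"
    and w: "completable x0 E w"
    and inf: "filterlim (\<lambda>z. cmod (w z)) at_top (nontangential x0 E)"
  defines "v \<equiv> \<lambda>z. - 1 / w z"
  assumes finite: "Liminf (at (complex_of_real x0) within E) (\<lambda>z. ereal (Re (nev_kernel v z z))) \<noteq> \<infinity>"
    (is "?L \<noteq> \<infinity>")
  obtains d where "?L = ereal d"
    "((\<lambda>z. v z / (z - complex_of_real x0)) \<longlongrightarrow> of_real d) (nontangential x0 E)"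
proof -
  let ?x = "complex_of_real x0"
  have v: "completable x0 E v" unfolding v_def by (rule completable_minus_inverse[OF w nz])
  have freq: "frequently (\<lambda>z. Re (nev_kernel v z z) \<le> y) (at ?x within E)" if "?L < ereal y" for y
  proof (rule ccontr)
    assume "\<not> ?thesis"
    then have "eventually (\<lambda>z. ereal y \<le> ereal (Re (nev_kernel v z z))) (at ?x within E)"
      unfolding not_frequently by (rule eventually_mono) auto
    then have "ereal y \<le> ?L" by (rule Liminf_bounded)
    with that show False by simp
  qed
  \<comment> \<open>Values below \<open>- k\<close> contradict the lower bound that holds once
    \<open>v\<close> converges along a subsequence.\<close>
  have "?L \<noteq> - \<infinity>"
  proof
    assume L: "?L = - \<infinity>"
    have "frequently (\<lambda>z. Re (nev_kernel v z z) \<le> - real k) (at ?x within E)" for k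
      by (rule freq) (simp add: L)
    then obtain \<zeta> where \<zeta>: "\<And>k. \<zeta> k \<in> E" "\<And>k. Re (nev_kernel v (\<zeta> k) (\<zeta> k)) \<le> - real k" "\<zeta> \<longlonglongrightarrow> ?x"
      using frequently_at_sequence[of "\<lambda>k z. Re (nev_kernel v z z) \<le> - real k" ?x E] by blast
    have "Re (nev_kernel v (\<zeta> k) (\<zeta> k)) \<le> 0" for k using \<zeta>(2)[of k] by simp
    then obtain \<sigma> where \<sigma>: "strict_mono \<sigma>" "(\<lambda>k. v (\<zeta> (\<sigma> k))) \<longlonglongrightarrow> 0"
      using subsequence_tendsto_zero[OF E dense nz w inf \<zeta>(1,3), of 0] unfolding v_def by blast
    have "(\<lambda>k. \<zeta> (\<sigma> k)) \<longlonglongrightarrow> ?x" using LIMSEQ_subseq_LIMSEQ[OF \<zeta>(3) \<sigma>(1)] by (simp add: o_def)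
    then obtain c where c: "\<And>k. - c \<le> Re (nev_kernel v (\<zeta> (\<sigma> k)) (\<zeta> (\<sigma> k)))"
      using nev_kernel_diag_bounded_below[OF v \<zeta>(1) _ \<sigma>(2)] by blast
    obtain k :: nat where "c < real k" using reals_Archimedean2 by blast
    moreover have "real k \<le> real (\<sigma> k)" using seq_suble[OF \<sigma>(1)] by simp
    ultimately show False using c[of k] \<zeta>(2)[of "\<sigma> k"] by linarith
  qed
  with finite obtain d where L: "?L = ereal d" by (cases ?L) auto
  have "frequently (\<lambda>z. Re (nev_kernel v z z) \<le> d + 1 / real (Suc k)) (at ?x within E)" for k
    by (rule freq) (simp add: L)
  then obtain \<zeta> where \<zeta>: "\<And>k. \<zeta> k \<in> E" "\<And>k. Re (nev_kernel v (\<zeta> k) (\<zeta> k)) \<le> d + 1 / real (Suc k)" "\<zeta> \<longlonglongrightarrow> ?x"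
    using frequently_at_sequence[of "\<lambda>k z. Re (nev_kernel v z z) \<le> d + 1 / real (Suc k)" ?x E] by blast
  have "Re (nev_kernel v (\<zeta> k) (\<zeta> k)) \<le> d + 1" for k
  proof -
    have "1 / real (Suc k) \<le> 1" by simp
    with \<zeta>(2)[of k] show ?thesis by linarith
  qed
  then obtain \<sigma> where \<sigma>: "strict_mono \<sigma>" "(\<lambda>k. v (\<zeta> (\<sigma> k))) \<longlonglongrightarrow> 0"
    using subsequence_tendsto_zero[OF E dense nz w inf \<zeta>(1,3), of "d + 1"] unfolding v_def by blast
  have sub: "(\<lambda>k. \<zeta> (\<sigma> k)) \<longlonglongrightarrow> ?x" using LIMSEQ_subseq_LIMSEQ[OF \<zeta>(3) \<sigma>(1)] by (simp add: o_def)
  have "(\<lambda>k. d + 1 / real (Suc k)) \<longlonglongrightarrow> d + 0"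
    using LIMSEQ_inverse_real_of_nat by (intro tendsto_add tendsto_const) (simp add: inverse_eq_divide)
  from LIMSEQ_subseq_LIMSEQ[OF this \<sigma>(1)] have M: "(\<lambda>k. d + 1 / real (Suc (\<sigma> k))) \<longlonglongrightarrow> d"
    by (simp add: o_def)
  obtain n A B where cont: "\<And>l. l < n \<Longrightarrow> isCont (A l) ?x" "\<And>l. l < n \<Longrightarrow> isCont (B l) ?x"
    and psd: "psd_kernel E (completed_kernel v n A B)"
    using v unfolding completable_def by blast
  \<comment> \<open>The slack \<open>1 / (\<sigma> k + 1)\<close> tends to 0, so the upper bounds
    converge to the limit inferior itself and \<open>m = d\<close> is also the minimal
    value.\<close>
  interpret boundary_sequence v E x0 n A B "\<lambda>k. \<zeta> (\<sigma> k)" "\<lambda>k. d + 1 / real (Suc (\<sigma> k))" 0 d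
    by unfold_locales (use E cont psd \<zeta> \<sigma> sub M in auto)
  have "eventually (\<lambda>z. d - e < Re (nev_kernel v z z)) (at ?x within E)" if "0 < e" for e
  proof -
    have "ereal (d - e) < ?L" using that by (simp add: L)
    from less_LiminfD[OF this] show ?thesis by simp
  qed
  then have "(g \<longlongrightarrow> of_real d) (nontangential x0 E)" using g_tendsto[OF dense] by blast
  moreover have "g = (\<lambda>z. v z / (z - ?x))" by (simp add: g_def fun_eq_iff)
  ultimately show ?thesis using that[OF L] by simp
qed

text \<open>A point of \<open>D\<close> with value outside \<open>S\<close> would have a
  neighbourhood of such points, and this meets \<open>E\<close>. Openness of \<open>R\<close> keeps
  the neighbourhood inside the region.\<close>

lemma eventually_in_closed_dense:
  fixes h :: "complex \<Rightarrow> 'a :: topological_space"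
  assumes R: "open R" and cont: "\<And>z. z \<in> R \<Longrightarrow> z \<in> D \<Longrightarrow> isCont h z"
    and dense: "\<And>z e. z \<in> R \<Longrightarrow> 0 < e \<Longrightarrow> \<exists>u\<in>E. dist u z < e"
    and S: "closed S" and x: "x \<notin> R"
    and ev: "eventually (\<lambda>z. h z \<in> S) (at x within (R \<inter> E))"
  shows "eventually (\<lambda>z. h z \<in> S) (at x within (R \<inter> D))"
proof -
  obtain d where "d > 0" "\<forall>z\<in>R \<inter> E. z \<noteq> x \<and> dist z x < d \<longrightarrow> h z \<in> S"
    using ev unfolding eventually_at by blast
  then have d: "d > 0" "\<And>z. z \<in> R \<Longrightarrow> z \<in> E \<Longrightarrow> dist z x < d \<Longrightarrow> h z \<in> S"
    using x by auto
  have "h z \<in> S" if z: "z \<in> R" "z \<in> D" "dist z x < d" for z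
  proof (rule ccontr)
    assume "h z \<notin> S"
    moreover have "(h \<longlongrightarrow> h z) (nhds z)"
      using cont[OF z(1,2)] by (simp add: isCont_def tendsto_at_iff_tendsto_nhds)
    ultimately have "eventually (\<lambda>u. h u \<in> - S) (nhds z)"
      using S by (intro topological_tendstoD) auto
    moreover have "eventually (\<lambda>u. u \<in> R \<inter> ball x d) (nhds z)"
      using z R by (intro eventually_nhds_in_open) (auto simp: dist_commute)
    ultimately have "eventually (\<lambda>u. h u \<in> - S \<and> u \<in> R \<inter> ball x d) (nhds z)" by (rule eventually_conj)
    then obtain e where e: "e > 0" "\<And>u. dist u z < e \<Longrightarrow> h u \<in> - S \<and> u \<in> R \<inter> ball x d"
      unfolding eventually_nhds_metric by blast
    obtain u where "u \<in> E" "dist u z < e" using dense[OF z(1) e(1)] by blast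
    with e(2)[of u] d(2)[of u] show False by (auto simp: dist_commute)
  qed
  then show ?thesis unfolding eventually_at using d(1) by blast
qed

lemma open_upper_half_plane: "open upper_half_plane"
  by (simp add: open_halfspace_Im_gt)

lemma open_nontangential_region: "open (nontangential_region a x0)"
proof -
  have "nontangential_region a x0 = upper_half_plane \<inter> {z. cmod (z - complex_of_real x0) < a * Im z}"
    by (auto simp: nontangential_region_def)
  also have "open \<dots>"
    by (intro open_Int open_upper_half_plane open_Collect_less continuous_intros)
  finally show ?thesis .
qed

lemma nontangential_tendsto_dense:
  fixes h :: "complex \<Rightarrow> complex"
  assumes cont: "\<And>z. z \<in> D \<Longrightarrow> isCont h z"
    and dense: "\<And>z e. 0 < Im z \<Longrightarrow> 0 < e \<Longrightarrow> \<exists>u\<in>E. dist u z < e"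
    and lim: "(h \<longlongrightarrow> l) (nontangential x0 E)"
  shows "(h \<longlongrightarrow> l) (nontangential x0 D)"
proof (rule tendstoI)
  fix e :: real assume e: "0 < e"
  \<comment> \<open>A closed ball, since only closed conditions extend from \<open>E\<close> to
    \<open>D\<close>; the half radius restores the strict inequality.\<close>
  have "eventually (\<lambda>z. h z \<in> cball l (e / 2)) (nontangential x0 E)"
    using tendstoD[OF lim, of "e / 2"] e by (auto elim: eventually_mono simp: dist_commute)
  then have evE: "eventually (\<lambda>z. h z \<in> cball l (e / 2))
      (at (complex_of_real x0) within (nontangential_region a x0 \<inter> E))" if "1 < a" for a
    using that unfolding eventually_nontangential by blast
  have "eventually (\<lambda>z. h z \<in> cball l (e / 2))
      (at (complex_of_real x0) within (nontangential_region a x0 \<inter> D))" if a: "1 < a" for a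
    by (rule eventually_in_closed_dense[OF open_nontangential_region cont _ closed_cball _ evE[OF a]])
      (use dense in \<open>auto simp: nontangential_region_def\<close>)
  then have "eventually (\<lambda>z. h z \<in> cball l (e / 2)) (nontangential x0 D)"
    unfolding eventually_nontangential by blast
  then show "eventually (\<lambda>z. dist (h z) l < e) (nontangential x0 D)"
    by (rule eventually_mono) (use e in \<open>auto simp: dist_commute\<close>)
qed

lemma nontangential_mono:
  assumes "E \<subseteq> D"
  shows "nontangential x0 E \<le> nontangential x0 D"
  unfolding nontangential_def by (intro SUP_mono') (rule at_le, use assms in auto)

lemma Liminf_dense:
  fixes h :: "complex \<Rightarrow> real"
  assumes ED: "E \<subseteq> D" "D \<subseteq> upper_half_plane" and cont: "\<And>z. z \<in> D \<Longrightarrow> isCont h z"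
    and dense: "\<And>z e. 0 < Im z \<Longrightarrow> 0 < e \<Longrightarrow> \<exists>u\<in>E. dist u z < e"
  shows "Liminf (at (complex_of_real x0) within D) (\<lambda>z. ereal (h z)) =
    Liminf (at (complex_of_real x0) within E) (\<lambda>z. ereal (h z))" (is "?LD = ?LE")
proof (rule antisym)
  let ?x = "complex_of_real x0"
  show "?LD \<le> ?LE"
    unfolding le_Liminf_iff using at_le[OF ED(1)] less_LiminfD filter_leD by blast
  show "?LE \<le> ?LD"
    unfolding le_Liminf_iff
  proof (intro allI impI)
    fix y assume "y < ?LE"
    then obtain y' where y': "y < ereal y'" "ereal y' < ?LE" using ereal_dense2 by blast
    from less_LiminfD[OF y'(2)] have "eventually (\<lambda>z. h z \<in> {y'..}) (at ?x within E)"
      by (rule eventually_mono) auto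
    then have "eventually (\<lambda>z. h z \<in> {y'..}) (at ?x within (upper_half_plane \<inter> E))"
      using filter_leD[OF at_le[of "upper_half_plane \<inter> E" E]] by blast
    then have "eventually (\<lambda>z. h z \<in> {y'..}) (at ?x within (upper_half_plane \<inter> D))"
      by (rule eventually_in_closed_dense[OF open_upper_half_plane, rotated -1]) (use cont dense in auto)
    moreover have "upper_half_plane \<inter> D = D" using ED(2) by blast
    ultimately have "eventually (\<lambda>z. h z \<in> {y'..}) (at ?x within D)" by simp
    then show "eventually (\<lambda>z. y < ereal (h z)) (at ?x within D)"
      by (rule eventually_mono) (use y'(1) in \<open>auto intro: less_le_trans\<close>)
  qed
qed

section \<open>Nontangential limits of derivatives\<close>

lemma analyticity_domain_cofinite_near:
  assumes w: "w nicely_meromorphic_on upper_half_plane" and p: "0 < Im p"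
  shows "eventually (\<lambda>z. z \<in> analyticity_domain w) (at p)"
proof -
  have "w meromorphic_on {p}"
    using w p meromorphic_on_subset unfolding nicely_meromorphic_on_def by blast
  then obtain r where r: "r > 0" "w analytic_on ball p r - {p}"
    using meromorphic_on_isolated_singularity unfolding isolated_singularity_at_def by blast
  have "eventually (\<lambda>z. z \<in> ball p r - {p}) (at p)"
    using r(1) by (intro eventually_at_in_open) auto
  then have "eventually (\<lambda>z. w analytic_on {z}) (at p)"
    by (rule eventually_mono) (use r(2) analytic_on_subset in blast)
  moreover have "eventually (\<lambda>z. z \<in> upper_half_plane) (at p)"
    using p by (intro eventually_at_in_open' open_upper_half_plane) auto
  ultimately show ?thesis by eventually_elim (auto simp: analyticity_domain_def)
qed

text \<open>Limits within the domain of analyticity do not see poles, but the discs and segments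
  used below must avoid them. At a pole \<open>h\<close> would blow up, although it is bounded at
  the surrounding points of the domain.\<close>

lemma no_poles_in_nontangential_region:
  assumes w: "w nicely_meromorphic_on upper_half_plane"
    and pole: "\<And>p. 0 < Im p \<Longrightarrow> is_pole w p \<Longrightarrow> filterlim h at_infinity (at p)"
    and bound: "eventually (\<lambda>z. cmod (h z) \<le> b)
      (at (complex_of_real x0) within (nontangential_region a x0 \<inter> analyticity_domain w))"
  obtains d where "0 < d" "\<And>z. z \<in> nontangential_region a x0 \<Longrightarrow> cmod (z - complex_of_real x0) < d \<Longrightarrow>
    z \<in> analyticity_domain w \<and> cmod (h z) \<le> b"
proof -
  let ?x = "complex_of_real x0" and ?D = "analyticity_domain w" and ?R = "nontangential_region a x0"
  obtain d where d: "0 < d" "\<forall>z\<in>?R \<inter> ?D. z \<noteq> ?x \<and> dist z ?x < d \<longrightarrow> cmod (h z) \<le> b"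
    using bound unfolding eventually_at by blast
  have hb: "cmod (h z) \<le> b" if "z \<in> ?R" "z \<in> ?D" "dist z ?x < d" for z
  proof -
    have "z \<noteq> ?x" using that(1) by (auto simp: nontangential_region_def)
    then show ?thesis using d(2) that by blast
  qed
  have inD: "p \<in> ?D" if p: "p \<in> ?R" "dist p ?x < d" for p
  proof (rule ccontr)
    assume "p \<notin> ?D"
    have Im: "0 < Im p" using p by (auto simp: nontangential_region_def)
    with \<open>p \<notin> ?D\<close> have "is_pole w p"
      using nicely_meromorphic_on_imp_analytic_at[OF w, of p] by (auto simp: analyticity_domain_def)
    then have "filterlim h at_infinity (at p)" by (rule pole[OF Im])
    then have "eventually (\<lambda>z. \<bar>b\<bar> + 1 \<le> cmod (h z)) (at p)"
      using filterlim_at_infinity[of 0 h "at p"] by auto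
    moreover have "eventually (\<lambda>z. z \<in> ?D) (at p)"
      by (rule analyticity_domain_cofinite_near[OF w Im])
    moreover have "eventually (\<lambda>z. z \<in> ?R \<inter> ball ?x d) (at p)"
      using p open_nontangential_region by (intro eventually_at_in_open') (auto simp: dist_commute)
    ultimately have "eventually (\<lambda>z. False) (at p)"
    proof eventually_elim
      case (elim z)
      then have "cmod (h z) \<le> b" by (intro hb) (auto simp: dist_commute)
      with elim(1) show False by linarith
    qed
    then show False by simp
  qed
  show ?thesis by (rule that[OF d(1)]) (use inD hb in \<open>auto simp: dist_norm\<close>)
qed

lemma convex_nontangential_region: "convex (nontangential_region a x0)"
proof (rule convexI)
  let ?x = "complex_of_real x0"
  fix z u and s t :: real
  assume z: "z \<in> nontangential_region a x0" and u: "u \<in> nontangential_region a x0"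
    and st: "0 \<le> s" "0 \<le> t" "s + t = 1"
  have *: "s * p + t * q < s * p' + t * q'" if "p < p'" "q < q'" for p q p' q' :: real
  proof (cases "s = 0")
    case True
    then show ?thesis using st that by simp
  next
    case False
    then have "s * p < s * p'" "t * q \<le> t * q'" using st that by (auto intro!: mult_left_mono)
    then show ?thesis by linarith
  qed
  have "of_real s * ?x + of_real t * ?x = ?x"
    using st(3) by (metis distrib_right mult_1 of_real_1 of_real_add)
  then have "s *\<^sub>R z + t *\<^sub>R u - ?x = s *\<^sub>R (z - ?x) + t *\<^sub>R (u - ?x)"
    by (simp add: scaleR_conv_of_real algebra_simps)
  then have "cmod (s *\<^sub>R z + t *\<^sub>R u - ?x) \<le> s * cmod (z - ?x) + t * cmod (u - ?x)"
    using norm_triangle_ineq[of "s *\<^sub>R (z - ?x)" "t *\<^sub>R (u - ?x)"] st by simp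
  also have "\<dots> < s * (a * Im z) + t * (a * Im u)"
    using z u by (intro *) (auto simp: nontangential_region_def)
  finally have "cmod (s *\<^sub>R z + t *\<^sub>R u - ?x) < a * Im (s *\<^sub>R z + t *\<^sub>R u)"
    by (simp add: algebra_simps)
  moreover have "0 < Im (s *\<^sub>R z + t *\<^sub>R u)"
    using *[of 0 "Im z" 0 "Im u"] z u by (auto simp: nontangential_region_def)
  ultimately show "s *\<^sub>R z + t *\<^sub>R u \<in> nontangential_region a x0"
    by (simp add: nontangential_region_def)
qed

lemma filterlim_mult_pole_at_infinity:
  fixes g w :: "complex \<Rightarrow> complex"
  assumes "is_pole w p" "isCont g p" "g p \<noteq> 0"
  shows "filterlim (\<lambda>z. g z * w z) at_infinity (at p)"
  using assms by (intro tendsto_mult_filterlim_at_infinity[of g "g p"]) (auto simp: is_pole_def isCont_def)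

text \<open>With \<open>h = (z - x0) w - c\<close>, the expression in question minus
  \<open>c\<close> is \<open>h - (z - x0) h'\<close>. Cauchy's estimate on a disc of radius
  proportional to \<open>|z - x0|\<close> controls \<open>h'\<close>; the disc leaves the region of
  aperture \<open>a\<close> but stays in that of \<open>2 * a\<close>.\<close>

lemma deriv_nontangential_limit:
  assumes w: "w nicely_meromorphic_on upper_half_plane"
    and lim: "((\<lambda>z. (z - complex_of_real x0) * w z) \<longlongrightarrow> c) (nontangential x0 (analyticity_domain w))"
  shows "((\<lambda>z. - ((z - complex_of_real x0)\<^sup>2 * deriv w z)) \<longlongrightarrow> c) (nontangential x0 (analyticity_domain w))"
  unfolding filterlim_nontangential
proof (intro allI impI tendstoI)
  let ?x = "complex_of_real x0" and ?D = "analyticity_domain w"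
  fix a e :: real assume a: "1 < a" and e: "0 < e"
  define e' where "e' = e / (2 * (1 + 4 * a))"
  have e': "0 < e'" using a e by (simp add: e'_def)
  let ?h = "\<lambda>z. (z - ?x) * w z - c"
  have "1 < 2 * a" using a by simp
  with lim have "(?h \<longlongrightarrow> 0) (at ?x within (nontangential_region (2 * a) x0 \<inter> ?D))"
    unfolding filterlim_nontangential by (intro LIM_zero) blast
  from tendstoD[OF this e'] have ev: "eventually (\<lambda>z. cmod (?h z) \<le> e') (at ?x within (nontangential_region (2 * a) x0 \<inter> ?D))"
    by (rule eventually_mono) simp
  have pole: "filterlim ?h at_infinity (at p)" if p: "0 < Im p" "is_pole w p" for p
  proof -
    have "filterlim (\<lambda>z. (z - ?x) * w z) at_infinity (at p)"
      by (rule filterlim_mult_pole_at_infinity[OF p(2)]) (use p(1) in \<open>auto simp: complex_eq_iff\<close>)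
    then show ?thesis
      using tendsto_add_filterlim_at_infinity'[of _ "at p" "\<lambda>_. - c" "- c"] by simp
  qed
  from no_poles_in_nontangential_region[OF w pole ev]
  obtain d where d: "0 < d" "\<And>z. z \<in> nontangential_region (2 * a) x0 \<Longrightarrow> cmod (z - ?x) < d \<Longrightarrow> z \<in> ?D \<and> cmod (?h z) \<le> e'"
    by blast
  have main: "dist (- ((z - ?x)\<^sup>2 * deriv w z)) c < e" if z: "z \<in> nontangential_region a x0" "cmod (z - ?x) < d / 2" for z
  proof -
    define s where "s = cmod (z - ?x)"
    have Im: "0 < Im z" and cone: "s < a * Im z" using z by (auto simp: nontangential_region_def s_def)
    have "z \<noteq> ?x" using Im by auto
    then have s: "0 < s" by (simp add: s_def)
    \<comment> \<open>In the disc of this radius \<open>a Im u > 3 s / 4\<close> and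
      \<open>|u - x| < 5 s / 4\<close>, which gives aperture \<open>2 * a\<close>. Cauchy's estimate
      times \<open>s\<close> costs the factor \<open>4 * a\<close>, whence the choice of
      \<open>e'\<close>.\<close>
    define \<rho> where "\<rho> = s / (4 * a)"
    have \<rho>: "0 < \<rho>" "\<rho> < s / 4" using s a by (simp_all add: \<rho>_def field_simps)
    have near: "u \<in> ?D \<and> cmod (?h u) \<le> e'" if u: "u \<in> cball z \<rho>" for u
    proof (rule d(2))
      have uz: "cmod (u - z) \<le> \<rho>" using u by (simp add: dist_norm norm_minus_commute)
      have "cmod (u - ?x) \<le> cmod (u - z) + cmod (z - ?x)" using norm_triangle_ineq[of "u - z" "z - ?x"] by simp
      then have 1: "cmod (u - ?x) < 5 / 4 * s" using uz \<rho> by (simp add: s_def)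
      then show "cmod (u - ?x) < d" using z(2) norm_ge_zero[of "z - ?x"] unfolding s_def by linarith
      have "\<bar>Im u - Im z\<bar> \<le> \<rho>" using abs_Im_le_cmod[of "u - z"] uz by simp
      then have "Im u \<ge> Im z - \<rho>" by linarith
      moreover have "a * \<rho> = s / 4" using a by (simp add: \<rho>_def)
      ultimately have "a * Im u \<ge> a * Im z - s / 4"
        using a mult_left_mono[of "Im z - \<rho>" "Im u" a] by (simp add: algebra_simps)
      then have 2: "a * Im u > 3 / 4 * s" using cone by linarith
      then have "0 < a * Im u" using s by linarith
      then have "0 < Im u" using a by (simp add: zero_less_mult_iff)
      then show "u \<in> nontangential_region (2 * a) x0" using 1 2 s by (auto simp: nontangential_region_def)
    qed
    have "w analytic_on {u}" if "u \<in> cball z \<rho>" for u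
      using near[OF that] by (auto simp: analyticity_domain_def)
    then have an: "w analytic_on cball z \<rho>"
      using analytic_on_analytic_at[of w "cball z \<rho>"] by blast
    then have hol: "?h holomorphic_on cball z \<rho>"
      by (intro holomorphic_intros analytic_imp_holomorphic)
    have "norm ((deriv ^^ 1) ?h z) \<le> fact 1 * e' / \<rho> ^ 1"
    proof (rule Cauchy_inequality)
      show "?h holomorphic_on ball z \<rho>" using hol ball_subset_cball holomorphic_on_subset by blast
      show "continuous_on (cball z \<rho>) ?h" by (rule holomorphic_on_imp_continuous_on[OF hol])
      fix u assume "cmod (z - u) = \<rho>"
      then show "cmod (?h u) \<le> e'" using near[of u] by (simp add: dist_norm)
    qed (use \<rho> in auto)
    moreover have "deriv ?h z = w z + (z - ?x) * deriv w z"
    proof -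
      have "w analytic_on {z}" using an \<rho>(1) by (meson analytic_on_subset centre_in_cball empty_subsetI insert_subset less_imp_le)
      then have "(w has_field_derivative deriv w z) (at z)"
        using analytic_on_imp_differentiable_at DERIV_deriv_iff_field_differentiable by blast
      then have "(?h has_field_derivative (w z + (z - ?x) * deriv w z)) (at z)"
        by (auto intro!: derivative_eq_intros)
      then show ?thesis by (rule DERIV_imp_deriv)
    qed
    ultimately have "cmod (w z + (z - ?x) * deriv w z) \<le> e' / \<rho>" by simp
    then have "s * cmod (w z + (z - ?x) * deriv w z) \<le> s * (e' / \<rho>)" using s by (intro mult_left_mono) auto
    also have "s * (e' / \<rho>) = 4 * a * e'" using s a by (simp add: \<rho>_def)
    finally have 1: "cmod ((z - ?x) * (w z + (z - ?x) * deriv w z)) \<le> 4 * a * e'" by (simp add: norm_mult s_def)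
    have "- ((z - ?x)\<^sup>2 * deriv w z) - c = ?h z - (z - ?x) * (w z + (z - ?x) * deriv w z)"
      by (simp add: power2_eq_square algebra_simps)
    then have "dist (- ((z - ?x)\<^sup>2 * deriv w z)) c \<le> e' + 4 * a * e'"
      unfolding dist_norm using 1 near[of z] \<rho>(1) norm_triangle_ineq4[of "?h z" "(z - ?x) * (w z + (z - ?x) * deriv w z)"]
      by (simp only:) auto
    also have "\<dots> = (1 + 4 * a) * e'" by (simp add: algebra_simps)
    also have "\<dots> = e / 2" unfolding e'_def using a nonzero_mult_divide_mult_cancel_left[of "1 + 4 * a" e 2]
      by (simp add: mult.commute)
    finally show ?thesis using e by simp
  qed
  show "eventually (\<lambda>z. dist (- ((z - ?x)\<^sup>2 * deriv w z)) c < e) (at ?x within (nontangential_region a x0 \<inter> ?D))"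
    unfolding eventually_at by (intro exI[of _ "d / 2"]) (use d(1) main in \<open>auto simp: dist_norm\<close>)
qed

text \<open>The function \<open>W = w - c / (z - x0)\<close> has derivative at most
  \<open>e' / (Im z)^2\<close>. Integration gives growth of at most order \<open>e' / Im z\<close>,
  which the factor \<open>z - x0\<close> turns into a multiple of \<open>a e'\<close>.\<close>

lemma nontangential_limit_of_deriv:
  assumes w: "w nicely_meromorphic_on upper_half_plane"
    and lim: "((\<lambda>z. - ((z - complex_of_real x0)\<^sup>2 * deriv w z)) \<longlongrightarrow> c) (nontangential x0 (analyticity_domain w))"
  shows "((\<lambda>z. (z - complex_of_real x0) * w z) \<longlongrightarrow> c) (nontangential x0 (analyticity_domain w))"
  unfolding filterlim_nontangential
proof (intro allI impI tendstoI)
  let ?x = "complex_of_real x0" and ?D = "analyticity_domain w"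
  fix a e :: real assume a: "1 < a" and e: "0 < e"
  let ?R = "nontangential_region a x0"
  define e' where "e' = e / (8 * a)"
  have e': "0 < e'" using a e by (simp add: e'_def)
  let ?h = "\<lambda>z. - ((z - ?x)\<^sup>2 * deriv w z) - c"
  from lim a have "(?h \<longlongrightarrow> 0) (at ?x within (?R \<inter> ?D))"
    unfolding filterlim_nontangential by (intro LIM_zero) blast
  from tendstoD[OF this e'] have ev: "eventually (\<lambda>z. cmod (?h z) \<le> e') (at ?x within (?R \<inter> ?D))"
    by (rule eventually_mono) simp
  have pole: "filterlim ?h at_infinity (at p)" if p: "0 < Im p" "is_pole w p" for p
  proof -
    have "w meromorphic_on {p}"
      using w p(1) meromorphic_on_subset unfolding nicely_meromorphic_on_def by blast
    with p have "is_pole (deriv w) p" by (simp add: is_pole_deriv_iff)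
    moreover have "p \<noteq> ?x" using p(1) by auto
    ultimately have "filterlim (\<lambda>z. - ((z - ?x)\<^sup>2) * deriv w z) at_infinity (at p)"
      by (intro filterlim_mult_pole_at_infinity) auto
    then show ?thesis
      using tendsto_add_filterlim_at_infinity'[of _ "at p" "\<lambda>_. - c" "- c"] by simp
  qed
  from no_poles_in_nontangential_region[OF w pole ev]
  obtain d where d: "0 < d" "\<And>z. z \<in> ?R \<Longrightarrow> cmod (z - ?x) < d \<Longrightarrow> z \<in> ?D \<and> cmod (?h z) \<le> e'"
    by blast
  define W where "W z = w z - c / (z - ?x)" for z
  define z0 where "z0 = ?x + \<i> * of_real (d / 2)"
  have z0: "z0 \<in> ?R" "cmod (z0 - ?x) = d / 2" "Im z0 = d / 2"
    using d(1) a by (auto simp: z0_def nontangential_region_def norm_mult)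
  have W': "\<exists>W'. (W has_field_derivative W') (at z) \<and> cmod W' \<le> e' / (Im z)\<^sup>2"
    if z: "z \<in> ?R" "cmod (z - ?x) < d" for z
  proof -
    have Im: "0 < Im z" using z by (auto simp: nontangential_region_def)
    then have zx: "z - ?x \<noteq> 0" by (auto simp: complex_eq_iff)
    have "w analytic_on {z}" using d(2)[OF z] by (auto simp: analyticity_domain_def)
    then have "(w has_field_derivative deriv w z) (at z)"
      using analytic_on_imp_differentiable_at DERIV_deriv_iff_field_differentiable by blast
    then have "(W has_field_derivative (deriv w z + c / (z - ?x)\<^sup>2)) (at z)"
      unfolding W_def using zx by (auto intro!: derivative_eq_intros simp: power2_eq_square)
    moreover have "cmod (deriv w z + c / (z - ?x)\<^sup>2) \<le> e' / (Im z)\<^sup>2"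
    proof -
      have "deriv w z + c / (z - ?x)\<^sup>2 = - ?h z / (z - ?x)\<^sup>2" using zx by (simp add: field_simps)
      then have "cmod (deriv w z + c / (z - ?x)\<^sup>2) = cmod (?h z) / (cmod (z - ?x))\<^sup>2"
        by (simp only: norm_divide norm_minus_cancel norm_power)
      also have "\<dots> \<le> e' / (Im z)\<^sup>2"
      proof (rule frac_le)
        have "Im z \<le> cmod (z - ?x)" using abs_Im_le_cmod[of "z - ?x"] by simp
        then show "(Im z)\<^sup>2 \<le> (cmod (z - ?x))\<^sup>2" using Im by (intro power_mono) auto
      qed (use d(2)[OF z] e' Im in auto)
      finally show ?thesis .
    qed
    ultimately show ?thesis by blast
  qed
  txt \<open>Integrate along the segment from \<open>z\<close> to the fixed point \<open>z0\<close>; there the imaginary part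
    grows linearly, so the integral of its inverse square is of order \<open>1 / Im z\<close>.\<close>
  have seg: "cmod (W z - W z0) \<le> 4 * e' / Im z" if z: "z \<in> ?R" "cmod (z - ?x) < d / 4" for z
  proof -
    \<comment> \<open>\<open>k\<close> is the rate at which the imaginary part grows along the
      segment. As \<open>y < d / 4\<close>, it exceeds \<open>d / 4\<close>, while the length
      \<open>L\<close> is below \<open>3 d / 4\<close>.\<close>
    define y k L where "y = Im z" and "k = d / 2 - y" and "L = cmod (z0 - z)"
    have y: "0 < y" "y < d / 4"
      using z abs_Im_le_cmod[of "z - ?x"] by (auto simp: y_def nontangential_region_def)
    have k: "d / 4 < k" "0 < k" using y d(1) by (auto simp: k_def)
    have L: "L \<le> 4 * k"
    proof -
      have "L \<le> cmod (z0 - ?x) + cmod (z - ?x)"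
        using norm_triangle_ineq4[of "z0 - ?x" "z - ?x"] by (simp add: L_def)
      then show ?thesis using z0(2) z(2) k by linarith
    qed
    define \<gamma> where "\<gamma> t = z + of_real t * (z0 - z)" for t :: real
    have \<gamma>: "\<gamma> t \<in> ?R" "cmod (\<gamma> t - ?x) < d" "Im (\<gamma> t) = y + t * k" if t: "0 \<le> t" "t \<le> 1" for t
    proof -
      have eq: "\<gamma> t = (1 - t) *\<^sub>R z + t *\<^sub>R z0" by (simp add: \<gamma>_def scaleR_conv_of_real algebra_simps)
      show "\<gamma> t \<in> ?R" unfolding eq
        using convexD_alt[OF convex_nontangential_region z(1) z0(1) t] by simp
      have "\<gamma> t \<in> ball ?x d" unfolding eq
        using convexD_alt[OF convex_ball[of ?x d] _ _ t, of z z0] z(2) z0(2) d(1)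
        by (simp add: dist_norm norm_minus_commute)
      then show "cmod (\<gamma> t - ?x) < d" by (simp add: dist_norm norm_minus_commute)
      show "Im (\<gamma> t) = y + t * k" by (simp add: \<gamma>_def y_def k_def z0(3))
    qed
    define g where "g t = W (\<gamma> t)" for t
    \<comment> \<open>A primitive of the bound \<open>e' L / (y + t k)^2\<close> for the derivative
      along the segment.\<close>
    define \<Phi> where "\<Phi> t = - (e' * L / k) / (y + t * k)" for t
    have pos: "0 < y + t * k" if "0 \<le> t" for t using y k that by (simp add: add_pos_nonneg)
    have "\<exists>W'. (W has_field_derivative W') (at (\<gamma> t)) \<and> cmod W' \<le> e' / (y + t * k)\<^sup>2" if "0 \<le> t" "t \<le> 1" for t
      using W'[OF \<gamma>(1,2)[OF that]] \<gamma>(3)[OF that] by simp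
    then obtain W1 where W1: "\<And>t. 0 \<le> t \<Longrightarrow> t \<le> 1 \<Longrightarrow> (W has_field_derivative W1 t) (at (\<gamma> t))"
      "\<And>t. 0 \<le> t \<Longrightarrow> t \<le> 1 \<Longrightarrow> cmod (W1 t) \<le> e' / (y + t * k)\<^sup>2"
      by metis
    have g': "(g has_vector_derivative (z0 - z) * W1 t) (at t)" if "0 \<le> t" "t \<le> 1" for t
    proof -
      have "(\<gamma> has_vector_derivative (z0 - z)) (at t)"
        unfolding \<gamma>_def by (auto intro!: derivative_eq_intros)
      from field_vector_diff_chain_at[OF this W1(1)[OF that]] show ?thesis
        unfolding g_def by (simp add: o_def)
    qed
    have \<Phi>': "(\<Phi> has_vector_derivative (e' * L / (y + t * k)\<^sup>2)) (at t)" if "0 \<le> t" for t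
    proof -
      have "((\<lambda>t. - b / (y + t * k)) has_real_derivative b * k / (y + t * k)\<^sup>2) (at t)" for b
        using pos[OF that] by (auto intro!: derivative_eq_intros simp: power2_eq_square)
      from this[of "e' * L / k"] show ?thesis
        using k by (simp add: \<Phi>_def[abs_def] has_real_derivative_iff_has_vector_derivative)
    qed
    have "norm (g 1 - g 0) \<le> \<Phi> 1 - \<Phi> 0"
    proof (rule differentiable_bound_general[where f' = "\<lambda>t. (z0 - z) * W1 t" and \<phi>' = "\<lambda>t. e' * L / (y + t * k)\<^sup>2"])
      show "continuous_on {0..1} g"
        by (rule continuous_on_vector_derivative) (use g' in \<open>auto intro: has_vector_derivative_at_within\<close>)
      show "continuous_on {0..1} \<Phi>"
        by (rule continuous_on_vector_derivative) (use \<Phi>' in \<open>auto intro: has_vector_derivative_at_within\<close>)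
      fix t :: real assume t: "0 < t" "t < 1"
      show "(g has_vector_derivative (z0 - z) * W1 t) (at t)" using g' t by auto
      show "(\<Phi> has_vector_derivative e' * L / (y + t * k)\<^sup>2) (at t)" using \<Phi>' t by auto
      have "norm ((z0 - z) * W1 t) \<le> L * (e' / (y + t * k)\<^sup>2)"
        unfolding norm_mult L_def using W1(2)[of t] t by (intro mult_left_mono) auto
      then show "norm ((z0 - z) * W1 t) \<le> e' * L / (y + t * k)\<^sup>2" by (simp add: mult.commute)
    qed auto
    also have "\<Phi> 1 - \<Phi> 0 \<le> e' * L / k / y"
      using e' k y by (simp add: \<Phi>_def L_def)
    also have "\<dots> \<le> 4 * e' / y"
      using L k y e' by (simp add: field_simps)
    finally show ?thesis by (simp add: g_def \<gamma>_def y_def norm_minus_commute)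
  qed
  \<comment> \<open>The first bound makes \<open>seg\<close> applicable; the second keeps the
    contribution of the constant \<open>W z0\<close> below \<open>e / 4\<close>, with
    \<open>1 +\<close> guarding against \<open>W z0 = 0\<close>.\<close>
  define \<eta> where "\<eta> = min (d / 4) (e / (4 * (1 + cmod (W z0))))"
  have \<eta>: "0 < \<eta>" using d(1) e by (auto simp: \<eta>_def add_pos_nonneg)
  have main: "dist ((z - ?x) * w z) c < e" if z: "z \<in> ?R" "cmod (z - ?x) < \<eta>" for z
  proof -
    have Im: "0 < Im z" and cone: "cmod (z - ?x) < a * Im z" using z by (auto simp: nontangential_region_def)
    then have zx: "z - ?x \<noteq> 0" by (auto simp: complex_eq_iff)
    have "(z - ?x) * w z - c = (z - ?x) * W z" using zx by (simp add: W_def right_diff_distrib)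
    then have "dist ((z - ?x) * w z) c = cmod (z - ?x) * cmod (W z)" by (simp add: dist_norm norm_mult)
    also have "\<dots> \<le> cmod (z - ?x) * (cmod (W z0) + 4 * e' / Im z)"
    proof (rule mult_left_mono)
      show "cmod (W z) \<le> cmod (W z0) + 4 * e' / Im z"
        using seg[OF z(1)] z(2) norm_triangle_ineq2[of "W z" "W z0"] by (simp add: \<eta>_def)
    qed simp
    also have "\<dots> = cmod (z - ?x) * cmod (W z0) + cmod (z - ?x) / Im z * (4 * e')"
      by (simp add: algebra_simps)
    also have "\<dots> \<le> e / 4 + a * (4 * e')"
    proof (rule add_mono)
      have "cmod (z - ?x) * cmod (W z0) \<le> e / (4 * (1 + cmod (W z0))) * (1 + cmod (W z0))"
        using z(2) e by (intro mult_mono) (auto simp: \<eta>_def)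
      also have "\<dots> = e / 4" using norm_ge_zero[of "W z0"] by (simp add: field_simps add_nonneg_eq_0_iff)
      finally show "cmod (z - ?x) * cmod (W z0) \<le> e / 4" .
      show "cmod (z - ?x) / Im z * (4 * e') \<le> a * (4 * e')"
        using cone Im e' by (intro mult_right_mono) (auto simp: field_simps)
    qed
    also have "\<dots> < e" using e a by (simp add: e'_def)
    finally show ?thesis .
  qed
  show "eventually (\<lambda>z. dist ((z - ?x) * w z) c < e) (at ?x within (?R \<inter> ?D))"
    unfolding eventually_at by (intro exI[of _ \<eta>]) (use \<eta> main in \<open>auto simp: dist_norm\<close>)
qed

section \<open>Equivalence of the boundary conditions at a generalized pole\<close>

text \<open>By the identity theorem, \<open>w\<close> cannot vanish on a disc without vanishing on
  the connected half plane.\<close>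

lemma nonzero_set_dense:
  assumes w: "w nicely_meromorphic_on upper_half_plane"
    and nz: "\<exists>z. 0 < Im z \<and> w z \<noteq> 0" and z: "0 < Im z" and e: "0 < e"
  shows "\<exists>u\<in>{z \<in> upper_half_plane. w z \<noteq> 0}. dist u z < e"
proof (rule ccontr)
  assume none: "\<not> ?thesis"
  have conn: "connected upper_half_plane" by (simp add: convex_connected convex_halfspace_Im_gt)
  have "eventually (\<lambda>u. u \<in> upper_half_plane \<inter> ball z e) (at z)"
    using z e open_upper_half_plane by (intro eventually_at_in_open') auto
  then have "eventually (\<lambda>u. w u = 0) (at z)"
    by (rule eventually_mono) (use none in \<open>auto simp: dist_commute\<close>)
  then have "frequently (\<lambda>u. w u = 0) (at z)" by (rule eventually_frequently[rotated]) simp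
  from frequently_eq_meromorphic_imp_constant[OF this w open_upper_half_plane conn] z nz
  show False by blast
qed

text \<open>The diagonal value is \<open>Re g + (Re (z - x0) / Im z) Im g\<close>. The ratio is
  bounded by \<open>a\<close> in the region, and \<open>Im g\<close> tends to 0 because
  \<open>d\<close> is real.\<close>

lemma nev_kernel_diag_tendsto:
  assumes E: "E \<subseteq> upper_half_plane"
    and lim: "((\<lambda>z. v z / (z - complex_of_real x0)) \<longlongrightarrow> complex_of_real d) (nontangential x0 E)"
  shows "((\<lambda>z. nev_kernel v z z) \<longlongrightarrow> complex_of_real d) (nontangential x0 E)"
  unfolding filterlim_nontangential
proof (intro allI impI)
  let ?x = "complex_of_real x0"
  fix a :: real assume a: "1 < a"
  let ?F = "at ?x within (nontangential_region a x0 \<inter> E)"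
  define g where "g z = v z / (z - ?x)" for z
  have g: "(g \<longlongrightarrow> of_real d) ?F"
    using lim a unfolding filterlim_nontangential g_def by blast
  have Im_g: "((\<lambda>z. Im (g z)) \<longlongrightarrow> 0) ?F" using tendsto_Im[OF g] by simp
  have in_F: "eventually (\<lambda>z. z \<in> nontangential_region a x0 \<inter> E) ?F"
    by (simp add: eventually_at_filter)
  have "((\<lambda>z. Re (z - ?x) / Im z * Im (g z)) \<longlongrightarrow> 0) ?F"
  proof (rule Lim_null_comparison)
    show "((\<lambda>z. a * \<bar>Im (g z)\<bar>) \<longlongrightarrow> 0) ?F"
      using tendsto_mult_right_zero[OF tendsto_rabs_zero[OF Im_g]] .
    show "eventually (\<lambda>z. norm (Re (z - ?x) / Im z * Im (g z)) \<le> a * \<bar>Im (g z)\<bar>) ?F"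
      using in_F
    proof eventually_elim
      case (elim z)
      then have Im: "0 < Im z" and cone: "cmod (z - ?x) < a * Im z" by (auto simp: nontangential_region_def)
      have "\<bar>Re (z - ?x)\<bar> / Im z \<le> a"
        using abs_Re_le_cmod[of "z - ?x"] cone Im by (simp add: field_simps)
      then have "\<bar>Re (z - ?x)\<bar> / Im z * \<bar>Im (g z)\<bar> \<le> a * \<bar>Im (g z)\<bar>" by (rule mult_right_mono) simp
      then show ?case using Im by (simp add: abs_mult abs_divide)
    qed
  qed
  then have "((\<lambda>z. complex_of_real (Re (g z) + Re (z - ?x) / Im z * Im (g z)))
      \<longlongrightarrow> of_real (Re (complex_of_real d) + 0)) ?F"
    by (intro tendsto_of_real tendsto_add tendsto_Re g)
  moreover have "eventually (\<lambda>z. of_real (Re (g z) + Re (z - ?x) / Im z * Im (g z)) = nev_kernel v z z) ?F"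
    using in_F
  proof eventually_elim
    case (elim z)
    then have Im: "0 < Im z" by (auto simp: nontangential_region_def)
    then have "z - ?x \<noteq> 0" by (auto simp: complex_eq_iff)
    then have "v z = (z - ?x) * g z" by (simp add: g_def)
    then have "Im (v z) = Im z * Re (g z) + Re (z - ?x) * Im (g z)" by simp
    then have "Im (v z) / Im z = Re (g z) + Re (z - ?x) / Im z * Im (g z)"
      using Im by (simp add: add_divide_distrib)
    then show ?case by (simp add: nev_kernel_diag)
  qed
  ultimately have "((\<lambda>z. nev_kernel v z z) \<longlongrightarrow> of_real (Re (complex_of_real d) + 0)) ?F"
    by (rule Lim_transform_eventually)
  then show "((\<lambda>z. nev_kernel v z z) \<longlongrightarrow> complex_of_real d) ?F" by simp
qed

lemma Liminf_le_nontangential_limit: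
  fixes h :: "complex \<Rightarrow> real"
  assumes nontriv: "nontangential x0 E \<noteq> bot" and lim: "(h \<longlongrightarrow> l) (nontangential x0 E)"
  shows "Liminf (at (complex_of_real x0) within E) (\<lambda>z. ereal (h z)) \<le> ereal l"
proof -
  have le: "nontangential x0 E \<le> at (complex_of_real x0) within E"
    unfolding nontangential_def by (intro SUP_least at_le) auto
  have "Liminf (at (complex_of_real x0) within E) (\<lambda>z. ereal (h z)) \<le> Liminf (nontangential x0 E) (\<lambda>z. ereal (h z))"
    unfolding le_Liminf_iff using le less_LiminfD filter_leD by blast
  also have "\<dots> = ereal l" by (rule lim_imp_Liminf[OF nontriv]) (simp add: lim)
  finally show ?thesis .
qed

text \<open>The kernel limit is that of \<open>v z / (z - x0) = - 1 / ((z - x0) w z)\<close>, so it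
  is \<open>- 1 / c\<close> and in general not \<open>c\<close>: for \<open>w = - 1 / z\<close> and
  \<open>x0 = 0\<close>, the kernel of \<open>v z = z\<close> is 1, while
  \<open>z w z = - 1\<close>.\<close>

theorem theorem1p7:
  fixes \<kappa> :: nat and w :: "complex \<Rightarrow> complex" and x0 :: real
  assumes "w \<in> gen_nevanlinna \<kappa>"
    and "filterlim (\<lambda>z. cmod (w z)) at_top (nontangential x0 (analyticity_domain w))"
  defines "v \<equiv> \<lambda>z. - 1 / w z"
  defines "is_d \<equiv> \<lambda>d::real. Liminf (at (complex_of_real x0) within analyticity_domain v)
      (\<lambda>z. ereal (Re (nev_kernel v z z))) = ereal d"
    and "is_d' \<equiv> \<lambda>d::real. ((\<lambda>z. nev_kernel v z z) \<longlongrightarrow> complex_of_real d)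
      (nontangential x0 (analyticity_domain v))"
    and "is_c \<equiv> \<lambda>c::real. ((\<lambda>z. (z - complex_of_real x0) * w z) \<longlongrightarrow> complex_of_real c)
      (nontangential x0 (analyticity_domain w))"
    and "is_c' \<equiv> \<lambda>c::real. ((\<lambda>z. - ((z - complex_of_real x0)\<^sup>2 * deriv w z)) \<longlongrightarrow> complex_of_real c)
      (nontangential x0 (analyticity_domain w))"
  shows "((\<exists>d. d \<noteq> 0 \<and> is_d d) \<longleftrightarrow> (\<exists>d'. d' \<noteq> 0 \<and> is_d' d')) \<and>
    ((\<exists>d'. d' \<noteq> 0 \<and> is_d' d') \<longleftrightarrow> (\<exists>c. c \<noteq> 0 \<and> is_c c)) \<and>
    ((\<exists>c. c \<noteq> 0 \<and> is_c c) \<longleftrightarrow> (\<exists>c'. c' \<noteq> 0 \<and> is_c' c')) \<and>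
    (\<forall>d d' c c'. d \<noteq> 0 \<and> is_d d \<and> d' \<noteq> 0 \<and> is_d' d' \<and> c \<noteq> 0 \<and> is_c c \<and> c' \<noteq> 0 \<and> is_c' c'
      \<longrightarrow> d = d' \<and> d' = - 1 / c \<and> c = c')"
proof -
  let ?x = "complex_of_real x0" and ?D = "analyticity_domain w" and ?Dv = "analyticity_domain v"
  \<comment> \<open>The representative vanishes at poles too, so \<open>E\<close> omits zeros and
    poles alike, and both \<open>w\<close> and \<open>v\<close> are analytic on it.\<close>
  define E where "E = {z \<in> upper_half_plane. w z \<noteq> 0}"
  have mero: "w nicely_meromorphic_on upper_half_plane"
    using assms(1) by (auto simp: gen_nevanlinna_def)
  have E: "E \<subseteq> upper_half_plane" and nz: "\<And>z. z \<in> E \<Longrightarrow> w z \<noteq> 0" by (auto simp: E_def)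
  have EDw: "w analytic_on {z}" if "z \<in> E" for z
  proof -
    have z: "0 < Im z" "w z \<noteq> 0" using that by (auto simp: E_def)
    then have "w \<midarrow>z\<rightarrow> w z" using mero by (auto simp: nicely_meromorphic_on_def)
    then have "\<not> is_pole w z" using is_pole_def not_tendsto_and_filterlim_at_infinity[of "at z"] by auto
    then show ?thesis using nicely_meromorphic_on_imp_analytic_at[OF mero] z by auto
  qed
  have ED: "E \<subseteq> ?D" using EDw E by (auto simp: analyticity_domain_def)
  have EDv: "E \<subseteq> ?Dv"
  proof
    fix z assume z: "z \<in> E"
    have "v analytic_on {z}" unfolding v_def
      using EDw[OF z] nz[OF z] by (intro analytic_intros) auto
    then show "z \<in> ?Dv" using z E by (auto simp: analyticity_domain_def)
  qed
  have D_up: "?D \<subseteq> upper_half_plane" "?Dv \<subseteq> upper_half_plane" by (auto simp: analyticity_domain_def)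
  \<comment> \<open>Were \<open>w\<close> identically 0, its modulus could not tend to infinity
    along a nontrivial filter.\<close>
  have "\<exists>z. 0 < Im z \<and> w z \<noteq> 0"
  proof (rule ccontr)
    assume none: "\<not> ?thesis"
    have zero: "w z = 0" if "0 < Im z" for z using none that by blast
    have an: "w analytic_on {z}" if z: "0 < Im z" for z
    proof -
      have "w holomorphic_on upper_half_plane"
        by (rule holomorphic_transform[of "\<lambda>_. 0"]) (use zero in auto)
      then show ?thesis using z open_upper_half_plane analytic_on_open analytic_on_subset[of w upper_half_plane "{z}"] by blast
    qed
    have nontriv: "nontangential x0 ?D \<noteq> bot"
    proof (rule nontangential_nontrivial[OF D_up(1)])
      fix z :: complex and e :: real assume "0 < Im z" "0 < e"
      then show "\<exists>u\<in>?D. dist u z < e" using an by (intro bexI[of _ z]) (auto simp: analyticity_domain_def)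
    qed
    have "eventually (\<lambda>z. 1 \<le> cmod (w z)) (nontangential x0 ?D)"
      using assms(2) by (simp add: filterlim_at_top)
    moreover have "eventually (\<lambda>z. z \<in> ?D) (nontangential x0 ?D)"
      unfolding eventually_nontangential by (auto simp: eventually_at_filter)
    ultimately have "eventually (\<lambda>_. False) (nontangential x0 ?D)"
      by eventually_elim (use zero D_up(1) in fastforce)
    with nontriv show False by (simp add: trivial_limit_def)
  qed
  then have dense: "\<exists>u\<in>E. dist u z < e" if "0 < Im z" "0 < e" for z e
    unfolding E_def by (rule nonzero_set_dense[OF mero _ that])
  have nontriv: "nontangential x0 E \<noteq> bot" by (rule nontangential_nontrivial[OF E dense])
  have inf: "filterlim (\<lambda>z. cmod (w z)) at_top (nontangential x0 E)"
    by (rule filterlim_mono[OF assms(2) order_refl nontangential_mono[OF ED]])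
  have compl: "completable x0 E w"
    by (rule completable_subset[OF gen_nevanlinna_completable[OF assms(1)] ED])
  have cont_w: "isCont w z" "isCont (\<lambda>z. (z - ?x) * w z) z" if "z \<in> ?D" for z
  proof -
    show "isCont w z" using that by (auto simp: analyticity_domain_def intro: analytic_at_imp_isCont)
    then show "isCont (\<lambda>z. (z - ?x) * w z) z" by (intro continuous_intros)
  qed
  have cont_K: "isCont (\<lambda>z. nev_kernel v z z) z" if z: "z \<in> ?Dv" for z
  proof -
    have "isCont v z" "Im z \<noteq> 0" using z by (auto simp: analyticity_domain_def intro: analytic_at_imp_isCont)
    then show ?thesis unfolding nev_kernel_diag
      by (intro continuous_of_real isCont_divide isCont_Im continuous_ident)
  qed
  have restrict: "(h \<longlongrightarrow> l) (nontangential x0 E)" if "(h \<longlongrightarrow> l) (nontangential x0 A)" "E \<subseteq> A"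
    for h :: "complex \<Rightarrow> complex" and l A
    using that nontangential_mono tendsto_mono by blast
  define K where "K z = Re (nev_kernel v z z)" for z
  let ?L = "Liminf (at ?x within E) (\<lambda>z. ereal (K z))"
  have is_d: "is_d d \<longleftrightarrow> ?L = ereal d" for d
  proof -
    have "isCont K z" if "z \<in> ?Dv" for z
      unfolding K_def using cont_K[OF that] by (rule isCont_Re)
    from Liminf_dense[OF EDv D_up(2) this dense] show ?thesis by (simp add: is_d_def K_def)
  qed
  have is_d': "is_d' d \<longleftrightarrow> ((\<lambda>z. nev_kernel v z z) \<longlongrightarrow> of_real d) (nontangential x0 E)" for d
    unfolding is_d'_def using nontangential_tendsto_dense[OF cont_K dense] restrict[OF _ EDv] by blast
  have is_c: "is_c c \<longleftrightarrow> ((\<lambda>z. (z - ?x) * w z) \<longlongrightarrow> of_real c) (nontangential x0 E)" for c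
    unfolding is_c_def using nontangential_tendsto_dense[OF cont_w(2) dense] restrict[OF _ ED] by blast
  have is_c': "is_c' c \<longleftrightarrow> is_c c" for c
    unfolding is_c_def is_c'_def
    using deriv_nontangential_limit[OF mero] nontangential_limit_of_deriv[OF mero] by blast
  define g where "g z = v z / (z - ?x)" for z
  have g_eq: "g z = - 1 / ((z - ?x) * w z)" for z by (simp add: g_def v_def mult.commute)
  have g_of_c: "(g \<longlongrightarrow> of_real (- 1 / c)) (nontangential x0 E)" if "is_c c" "c \<noteq> 0" for c
  proof -
    have "((\<lambda>z. - 1 / ((z - ?x) * w z)) \<longlongrightarrow> - 1 / of_real c) (nontangential x0 E)"
      using that is_c by (intro tendsto_divide tendsto_const) auto
    then show ?thesis by (simp add: g_eq[abs_def])
  qed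
  have c_of_g: "is_c (- 1 / d)" if "(g \<longlongrightarrow> of_real d) (nontangential x0 E)" "d \<noteq> 0" for d
  proof -
    have "((\<lambda>z. - 1 / g z) \<longlongrightarrow> - 1 / of_real d) (nontangential x0 E)"
      using that by (intro tendsto_divide tendsto_const) auto
    then show ?thesis unfolding is_c by (simp add: g_eq)
  qed
  have d'_of_g: "is_d' d" if "(g \<longlongrightarrow> of_real d) (nontangential x0 E)" for d
    unfolding is_d' using nev_kernel_diag_tendsto[OF E] that unfolding g_def by blast
  have g_of_L: "\<exists>d. ?L = ereal d \<and> (g \<longlongrightarrow> of_real d) (nontangential x0 E)" if "?L \<noteq> \<infinity>"
    using Liminf_nev_kernel_imp_nontangential_limit[OF E dense nz compl inf] that
    unfolding K_def g_def v_def by blast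
  have d'_unique: "a = b" if "is_d' a" "is_d' b" for a b
    using that tendsto_unique[OF nontriv] unfolding is_d' by (metis of_real_eq_iff)
  have c_unique: "a = b" if "is_c a" "is_c b" for a b
    using that tendsto_unique[OF nontriv] unfolding is_c by (metis of_real_eq_iff)
  have g_of_d: "(g \<longlongrightarrow> of_real d) (nontangential x0 E)" if "is_d d" for d
    using g_of_L that unfolding is_d by auto
  \<comment> \<open>The nontangential limit keeps \<open>?L\<close> below
    \<open>\<infinity>\<close>, so \<open>g_of_L\<close> produces some finite value \<open>b\<close>
    of \<open>?L\<close>; \<open>b\<close> is also a nontangential limit of the kernel, and
    uniqueness gives \<open>b = d\<close>.\<close>
  have d_of_d': "is_d d" if "is_d' d" for d
  proof -
    have "(K \<longlongrightarrow> d) (nontangential x0 E)"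
      unfolding K_def using tendsto_Re[OF that[unfolded is_d']] by simp
    then have "?L \<le> ereal d" by (rule Liminf_le_nontangential_limit[OF nontriv])
    then have "?L \<noteq> \<infinity>" by auto
    from g_of_L[OF this] obtain b where b: "?L = ereal b" "(g \<longlongrightarrow> of_real b) (nontangential x0 E)" by blast
    from d'_unique[OF d'_of_g[OF b(2)] that] b(1) show ?thesis by (simp add: is_d)
  qed
  have 12: "is_d d \<longleftrightarrow> is_d' d" for d using d_of_d' d'_of_g g_of_d by blast
  have 23: "is_c (- 1 / d)" if "is_d' d" "d \<noteq> 0" for d
    using c_of_g[OF g_of_d[OF d_of_d'[OF that(1)]] that(2)] .
  have 32: "is_d' (- 1 / c)" if "is_c c" "c \<noteq> 0" for c
    by (rule d'_of_g[OF g_of_c[OF that]])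
  have "d' = - 1 / c" if "is_d' d'" "is_c c" "c \<noteq> 0" for d' c
    by (rule d'_unique[OF that(1) 32[OF that(2,3)]])
  moreover have "(\<exists>d'. d' \<noteq> 0 \<and> is_d' d') \<longleftrightarrow> (\<exists>c. c \<noteq> 0 \<and> is_c c)"
  proof
    assume "\<exists>d'. d' \<noteq> 0 \<and> is_d' d'"
    then obtain d' where "d' \<noteq> 0" "is_d' d'" by blast
    with 23[of d'] show "\<exists>c. c \<noteq> 0 \<and> is_c c" by (intro exI[of _ "- 1 / d'"]) simp
  next
    assume "\<exists>c. c \<noteq> 0 \<and> is_c c"
    then obtain c where "c \<noteq> 0" "is_c c" by blast
    with 32[of c] show "\<exists>d'. d' \<noteq> 0 \<and> is_d' d'" by (intro exI[of _ "- 1 / c"]) simp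
  qed
  ultimately show ?thesis
    unfolding 12 is_c' using d'_unique c_unique by blast
qed

end
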